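(* Let $a,b,c,\lambda\in\mathbb{C}$ with $c\notin\{0,-1,-2,\ldots\}$, let $\varepsilon\in\{1,-1\}$, let $m\ge 1$ be an integer, put $M=m+\lambda$, and assume $\operatorname{Re}M>0$. If $\varepsilon=1$, assume also $\operatorname{Re}(c-a-b)>-1$. Then $$\varepsilon(M+1-a)(M+1-b)\,\Phi_{m,\varepsilon}=M(M+1-c)\,\Phi_{m-1,\varepsilon}+E_\varepsilon(M;a,b,c),$$ where $\Phi_{k,\varepsilon}=\int_0^1 x^{k+\lambda}F(a,b;c;\varepsilon x)\,dx$, and where the term $E_\varepsilon$ is, for $\varepsilon=1$, $$E_{+}(a,b,c)=\frac{\Gamma(c)\Gamma(c-a-b+1)}{\Gamma(c-a)\Gamma(c-b)}$$ (independent of $M$), and, for $\varepsilon=-1$, $$E_{-}(M;a,b,c)=(c+a+b-2M-2)\,F(a,b;c;-1)-2\left.\frac{d}{dz}F(a,b;c;z)\right|_{z=-1}.$$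
   Context: $F(a,b;c;z)={}_2F_1(a,b;c;z)$ is the Gauss hypergeometric function, given by $\sum_{n\ge0}\frac{(a)_n(b)_n}{(c)_n n!}z^n$ for $|z|<1$ and by its principal analytic continuation to $\mathbb{C}\setminus[1,\infty)$; the value and derivative at $z=-1$ are those of this analytic function. Here $(u)_0=1$ and $(u)_n=u(u+1)\cdots(u+n-1)$ for $n\ge1$. The function $1/\Gamma$ is entire, so $1/\Gamma(z)=0$ at non-positive integers $z$. *)

theory Defs
  imports "HOL-Complex_Analysis.Complex_Analysis"
begin

definition hyp2F1_coeff :: "complex \<Rightarrow> complex \<Rightarrow> complex \<Rightarrow> nat \<Rightarrow> complex" where
  "hyp2F1_coeff a b c n =
     pochhammer a n * pochhammer b n / (pochhammer c n * fact n)"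

definition slit_plane :: "complex set" where
  "slit_plane = - complex_of_real ` {1..}"

(* The principal branch: the holomorphic function on the plane cut along [1, oo) that is given
   by the Gauss series on the open unit disc. As the cut plane is connected, its values on
   slit_plane are uniquely determined; its values on the cut itself are left unspecified. *)
definition hyp2F1 :: "complex \<Rightarrow> complex \<Rightarrow> complex \<Rightarrow> complex \<Rightarrow> complex" where
  "hyp2F1 a b c =
     (SOME f. f holomorphic_on slit_plane \<and>
        (\<forall>z. norm z < 1 \<longrightarrow> (\<lambda>n. hyp2F1_coeff a b c n * z ^ n) sums f z))"

definition Phi_integrand ::
  "complex \<Rightarrow> complex \<Rightarrow> complex \<Rightarrow> complex \<Rightarrow> nat \<Rightarrow> real \<Rightarrow> real \<Rightarrow> complex" where
  "Phi_integrand a b c \<mu> k \<epsilon> x =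
     complex_of_real x powr (of_nat k + \<mu>) * hyp2F1 a b c (complex_of_real (\<epsilon> * x))"

(* Integration over the open interval avoids the point x = 1, which for \<epsilon> = 1 lies on the cut. *)
definition Phi ::
  "complex \<Rightarrow> complex \<Rightarrow> complex \<Rightarrow> complex \<Rightarrow> nat \<Rightarrow> real \<Rightarrow> complex" where
  "Phi a b c \<mu> k \<epsilon> = (LINT x:{0<..<1}|lborel. Phi_integrand a b c \<mu> k \<epsilon> x)"

(* rGamma is the entire function 1/Gamma, so E_plus vanishes when c - a or c - b is a
   non-positive integer. *)
definition E_plus :: "complex \<Rightarrow> complex \<Rightarrow> complex \<Rightarrow> complex" where
  "E_plus a b c = Gamma c * Gamma (c - a - b + 1) * rGamma (c - a) * rGamma (c - b)"

definition E_minus :: "complex \<Rightarrow> complex \<Rightarrow> complex \<Rightarrow> complex \<Rightarrow> complex" where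
  "E_minus M a b c =
     (c + a + b - 2 * M - 2) * hyp2F1 a b c (- 1) - 2 * deriv (hyp2F1 a b c) (- 1)"

definition E_term :: "real \<Rightarrow> complex \<Rightarrow> complex \<Rightarrow> complex \<Rightarrow> complex \<Rightarrow> complex" where
  "E_term \<epsilon> M a b c = (if \<epsilon> = 1 then E_plus a b c else E_minus M a b c)"

end

theory Submission
  imports Defs
begin

text \<open>
  Write \<theta> = x d/dx and f(x) = F(a,b;c;\<epsilon> x). The hypergeometric equation says
  \<theta>(\<theta> + c - 1) f = \<epsilon> x (\<theta> + a)(\<theta> + b) f. Multiplying by x^(M-1)
  and integrating by parts over (0,1) replaces \<theta> by -M on the left and by -(M+1) on
  the right. This turns the equation into the claimed relation between \<Phi>(m,\<epsilon>)
  and \<Phi>(m-1,\<epsilon>), up to a boundary term, and E(\<epsilon>) is the value of that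
  boundary term at x = 1. In other words, the combination of the two integrands is the
  derivative of an explicit function (\<open>mellin_boundary_deriv\<close>), which tends to 0 at
  x = 0 because Re M > 0 (\<open>mellin_boundary_tendsto_0\<close>), and the fundamental
  theorem of calculus gives the result. Three points need substantial work.

  First, \<^const>\<open>hyp2F1\<close> is defined by choosing a continuation of the Gauss series to the
  cut plane, so such a continuation has to be produced for all parameters
  (\<open>hyp2F1_continuation_exists\<close>). The substitution z = 4w/(1+w)^2 maps the unit disc onto
  the cut plane. In the variable w the equation has a regular singular point at 0 and no
  other singularity in the disc, hence its power series solutions converge in the disc
  (\<open>conv_radius_fuchsian\<close>).

  Secondly, for \<epsilon> = 1 the function F may be unbounded near 1, and the integrals converge
  because F is O((1-x)^(-\<sigma>)) for some \<sigma> < 1 (\<open>hyp2F1_bound_near_1\<close>). This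
  follows from the size of the coefficients, which Euler's limit for 1/\<Gamma> provides
  (\<open>pochhammer_ratio_asymptotics\<close>).

  Thirdly, for \<epsilon> = 1 the boundary term at x = 1 reduces to
  lim (x \<rightarrow> 1) [(1-x)F' + (c-a-b)F]. The bracket is
  (c-a)(c-b)/c F(a,b;c+1;x) (\<open>hyp2F1_contiguous\<close>), and since
  Re(c+1-a-b) > 0 its limit is given by Gauss's summation theorem
  (\<open>gauss_summation\<close>). For \<epsilon> = -1 the point -1 is interior to the cut plane, and
  the boundary term is simply evaluated there.
\<close>

unbundle no vec_syntax

section \<open>Power series solutions at a regular singular point\<close>

abbreviation fps_theta :: "complex fps \<Rightarrow> complex fps" where
  "fps_theta f \<equiv> fps_X * fps_deriv f"

lemma fps_theta_nth: "fps_theta f $ n = of_nat n * f $ n"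
  by (cases n) simp_all

lemma bounded_coeffs_inside_conv_radius:
  fixes p :: "complex fps"
  assumes "ereal \<rho> < fps_conv_radius p" "\<rho> > 0"
  obtains K where "K > 0" "\<And>n. norm (p $ n) * \<rho> ^ n \<le> K"
proof -
  have "summable (\<lambda>n. p $ n * of_real \<rho> ^ n)"
    using assms by (intro summable_fps) auto
  then have "Bseq (\<lambda>n. p $ n * of_real \<rho> ^ n)"
    using summable_LIMSEQ_zero convergent_imp_Bseq convergentI by blast
  then obtain K where "K > 0" "\<And>n. norm (p $ n * of_real \<rho> ^ n) \<le> K"
    by (elim BseqE) auto
  then show ?thesis using that assms by (auto simp: norm_mult norm_power)
qed

text \<open>
  The classical majorant argument of Frobenius. With \<theta> = z d/dz, comparing coefficients
  in \<theta>^2 f + p \<theta> f + q f = 0 expresses n^2 f_n through the f_k with k \<le> n.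
  If |p_j| \<rho>^j and |q_j| \<rho>^j are at most K, then the partial sums S_n of
  |f_k| \<rho>^k satisfy n^2 (S_n - S_(n-1)) \<le> K (n + 1) S_n, so S_n / S_(n-1) = 1 + O(1/n)
  and S_n grows more slowly than any geometric progression of ratio greater than 1.
\<close>

lemma conv_radius_fuchsian:
  fixes f p q :: "complex fps" and R :: ereal
  assumes ode: "fps_theta (fps_theta f) + p * fps_theta f + q * f = 0"
    and p: "fps_conv_radius p \<ge> R" and q: "fps_conv_radius q \<ge> R"
  shows "fps_conv_radius f \<ge> R"
  unfolding fps_conv_radius_def
proof (rule conv_radius_geI_ex)
  fix r :: real assume r: "0 < r" "ereal r < R"
  obtain \<rho> where \<rho>: "r < \<rho>" "ereal \<rho> < R"
    using r ereal_dense2[of "ereal r" R] by auto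
  obtain s where s: "r < s" "s < \<rho>" using \<rho>(1) dense by blast
  have pos: "0 < s" "0 < \<rho>" using r s by auto
  obtain K1 where K1: "K1 > 0" "\<And>n. norm (p $ n) * \<rho> ^ n \<le> K1"
    using bounded_coeffs_inside_conv_radius[of \<rho> p] \<rho> p pos by (metis order.strict_trans2)
  obtain K2 where K2: "K2 > 0" "\<And>n. norm (q $ n) * \<rho> ^ n \<le> K2"
    using bounded_coeffs_inside_conv_radius[of \<rho> q] \<rho> q pos by (metis order.strict_trans2)
  define K where "K = max K1 K2"
  have K: "K > 0" "\<And>n. norm (p $ n) * \<rho> ^ n \<le> K" "\<And>n. norm (q $ n) * \<rho> ^ n \<le> K"
    using K1 K2 by (auto simp: K_def le_max_iff_disj)
  define g where "g n = norm (f $ n) * \<rho> ^ n" for n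
  define S where "S n = (\<Sum>k\<le>n. g k)" for n
  have g_nonneg: "g n \<ge> 0" for n using pos by (simp add: g_def)
  have S_nonneg: "S n \<ge> 0" for n by (simp add: S_def sum_nonneg g_nonneg)
  have g_le: "real n ^ 2 * g n \<le> K * (real n + 1) * S n" for n
  proof -
    have "of_nat n ^ 2 * f $ n + (\<Sum>k\<le>n. (p $ (n - k) * of_nat k + q $ (n - k)) * f $ k) = 0"
    proof -
      have "(fps_theta (fps_theta f) + fps_theta f * p + f * q) $ n = 0"
        using ode by (simp add: mult.commute)
      then show ?thesis
        by (simp only: fps_add_nth fps_mult_nth[of _ p] fps_mult_nth[of _ q] fps_theta_nth)
           (simp add: atLeast0AtMost power2_eq_square algebra_simps sum.distrib)
    qed
    then have "of_nat n ^ 2 * f $ n = - (\<Sum>k\<le>n. (p $ (n - k) * of_nat k + q $ (n - k)) * f $ k)"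
      by (simp add: eq_neg_iff_add_eq_0)
    then have "real n ^ 2 * norm (f $ n)
        = norm (\<Sum>k\<le>n. (p $ (n - k) * of_nat k + q $ (n - k)) * f $ k)"
      by (metis norm_minus_cancel norm_mult norm_of_nat norm_power)
    also have "\<dots> \<le> (\<Sum>k\<le>n. (norm (p $ (n - k)) * real k + norm (q $ (n - k))) * norm (f $ k))"
      by (intro sum_norm_le)
         (auto simp: norm_mult intro!: mult_right_mono order.trans[OF norm_triangle_ineq])
    finally have "real n ^ 2 * g n
        \<le> (\<Sum>k\<le>n. (norm (p $ (n - k)) * real k + norm (q $ (n - k))) * norm (f $ k)) * \<rho> ^ n"
      using pos by (simp add: g_def mult_right_mono flip: mult.assoc)
    also have "\<dots> = (\<Sum>k\<le>n. (norm (p $ (n - k)) * \<rho> ^ (n - k) * real k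
                              + norm (q $ (n - k)) * \<rho> ^ (n - k)) * g k)"
      unfolding sum_distrib_right
    proof (rule sum.cong, goal_cases)
      case (2 k)
      then have "\<rho> ^ n = \<rho> ^ (n - k) * \<rho> ^ k" by (simp flip: power_add)
      then show ?case by (simp add: g_def algebra_simps)
    qed auto
    also have "\<dots> \<le> (\<Sum>k\<le>n. (K * real n + K) * g k)"
      using K by (intro sum_mono mult_right_mono add_mono mult_mono g_nonneg) (auto simp: pos less_imp_le)
    also have "\<dots> = K * (real n + 1) * S n"
      by (simp add: S_def sum_distrib_left sum.distrib algebra_simps)
    finally show ?thesis .
  qed
  \<comment> \<open>From this index on, the factor 2K/n is at most 1 - s/\<rho>.\<close>
  define N where "N = nat \<lceil>2 * K / (1 - s / \<rho>)\<rceil> + 1"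
  have contr: "S (Suc n) * (s / \<rho>) \<le> S n" if "n \<ge> N" for n
  proof -
    let ?m = "real (Suc n)"
    have d: "1 - s / \<rho> > 0" using s pos by (simp add: field_simps)
    have "2 * K / (1 - s / \<rho>) \<le> ?m" using that unfolding N_def by linarith
    then have mK: "2 * K \<le> (1 - s / \<rho>) * ?m" using d by (simp add: field_simps)
    have "?m * (?m * g (Suc n)) \<le> K * (?m + 1) * S (Suc n)"
      using g_le[of "Suc n"] by (simp add: power2_eq_square mult.assoc)
    also have "\<dots> \<le> K * (2 * ?m) * S (Suc n)"
      using K(1) by (intro mult_right_mono mult_left_mono S_nonneg) auto
    also have "\<dots> = ?m * (2 * K * S (Suc n))" by simp
    finally have "?m * g (Suc n) \<le> 2 * K * S (Suc n)"
      by (rule mult_left_le_imp_le) simp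
    also have "\<dots> \<le> (1 - s / \<rho>) * ?m * S (Suc n)"
      by (intro mult_right_mono mK S_nonneg)
    also have "\<dots> = ?m * ((1 - s / \<rho>) * S (Suc n))" by simp
    finally have "g (Suc n) \<le> (1 - s / \<rho>) * S (Suc n)"
      by (rule mult_left_le_imp_le) simp
    moreover have "S (Suc n) = S n + g (Suc n)" by (simp add: S_def)
    ultimately show ?thesis by (simp add: algebra_simps)
  qed
  \<comment> \<open>T eventually decreases and dominates |f_n| s^n, so \<Sum> f_n r^n converges for r < s.\<close>
  define T where "T n = S n * (s / \<rho>) ^ n" for n
  have T_le: "T n \<le> T N" if "n \<ge> N" for n
    using that
  proof (induction n rule: dec_induct)
    case (step n)
    have "T (Suc n) = S (Suc n) * (s / \<rho>) * (s / \<rho>) ^ n" by (simp add: T_def)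
    also have "\<dots> \<le> T n"
      unfolding T_def using contr[OF step(1)] pos by (intro mult_right_mono) auto
    finally show ?case using step by simp
  qed simp
  have "summable (\<lambda>n. f $ n * of_real r ^ n)"
  proof (rule summable_comparison_test'[where g = "\<lambda>n. T N * (r / s) ^ n" and N = N])
    show "summable (\<lambda>n. T N * (r / s) ^ n)"
      using r s by (intro summable_mult summable_geometric) auto
  next
    fix n assume n: "n \<ge> N"
    have "norm (f $ n * of_real r ^ n) = g n * (s / \<rho>) ^ n * (r / s) ^ n"
      using r pos by (simp add: g_def norm_mult norm_power power_divide)
    also have "\<dots> \<le> T n * (r / s) ^ n"
      unfolding T_def S_def using r pos g_nonneg
      by (intro mult_right_mono member_le_sum) auto
    also have "\<dots> \<le> T N * (r / s) ^ n"
      using r pos by (intro mult_right_mono T_le[OF n]) auto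
    finally show "norm (f $ n * of_real r ^ n) \<le> T N * (r / s) ^ n" .
  qed
  then show "\<exists>z. norm z = r \<and> summable (\<lambda>n. f $ n * z ^ n)"
    using r by (intro exI[of _ "of_real r"]) auto
qed

section \<open>The Gauss series and its differential equation\<close>

definition hyp2F1_fps :: "complex \<Rightarrow> complex \<Rightarrow> complex \<Rightarrow> complex fps" where
  "hyp2F1_fps a b c = Abs_fps (hyp2F1_coeff a b c)"

lemma hyp2F1_fps_nth [simp]: "hyp2F1_fps a b c $ n = hyp2F1_coeff a b c n"
  by (simp add: hyp2F1_fps_def)

lemma nonpos_Int_add_of_nat_neq_0: "c \<notin> \<int>\<^sub>\<le>\<^sub>0 \<Longrightarrow> c + of_nat n \<noteq> (0 :: complex)"
  using plus_of_nat_eq_0_imp by blast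

lemma hyp2F1_coeff_Suc:
  assumes "c \<notin> \<int>\<^sub>\<le>\<^sub>0"
  shows "(c + of_nat n) * (1 + of_nat n) * hyp2F1_coeff a b c (Suc n)
           = (a + of_nat n) * (b + of_nat n) * hyp2F1_coeff a b c n"
proof -
  have "pochhammer c n \<noteq> 0" "c + of_nat n \<noteq> 0" "(1 + of_nat n :: complex) \<noteq> 0"
    using assms pochhammer_eq_0_imp_nonpos_Int nonpos_Int_add_of_nat_neq_0[of c n]
    by (auto simp flip: of_nat_Suc)
  then show ?thesis
    by (simp add: hyp2F1_coeff_def pochhammer_Suc divide_simps)
qed

text \<open>
  The two-term recurrence of the coefficients, read as
  \<theta>(\<theta> + c - 1) F = z (\<theta> + a)(\<theta> + b) F.
\<close>

lemma hyp2F1_fps_ode: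
  fixes a b c :: complex
  assumes "c \<notin> \<int>\<^sub>\<le>\<^sub>0"
  defines "F \<equiv> hyp2F1_fps a b c"
  shows "fps_theta (fps_theta F) + fps_const (c - 1) * fps_theta F
           = fps_X * (fps_theta (fps_theta F) + fps_const (a + b) * fps_theta F + fps_const (a * b) * F)"
proof (rule fps_ext)
  fix n
  show "(fps_theta (fps_theta F) + fps_const (c - 1) * fps_theta F) $ n
      = (fps_X * (fps_theta (fps_theta F) + fps_const (a + b) * fps_theta F + fps_const (a * b) * F)) $ n"
  proof (cases n)
    case 0
    then show ?thesis by simp
  next
    case (Suc m)
    have "(fps_theta (fps_theta F) + fps_const (c - 1) * fps_theta F) $ Suc m
        = (c + of_nat m) * (1 + of_nat m) * hyp2F1_coeff a b c (Suc m)"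
      by (simp only: fps_add_nth fps_mult_left_const_nth fps_theta_nth)
         (simp add: F_def algebra_simps)
    also have "\<dots> = (a + of_nat m) * (b + of_nat m) * hyp2F1_coeff a b c m"
      by (rule hyp2F1_coeff_Suc[OF assms(1)])
    also have "\<dots> = (fps_theta (fps_theta F) + fps_const (a + b) * fps_theta F + fps_const (a * b) * F) $ m"
      by (simp only: fps_add_nth fps_mult_left_const_nth fps_theta_nth)
         (simp add: F_def algebra_simps)
    finally show ?thesis by (simp add: Suc)
  qed
qed

section \<open>Continuation to the slit plane\<close>

text \<open>
  The Koebe-type map w \<mapsto> 4w/(1+w)^2 sends the unit disc conformally onto the plane cut
  along [1,\<infinity>). The singular points 0, 1, \<infinity> of the hypergeometric equation
  correspond to w = 0 and w = \<plusminus> 1, so that in the variable w the equation has no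
  singularity inside the punctured unit disc. Its solution regular at w = 0 is therefore a
  power series that converges in the whole disc, and transporting it back gives the continuation of the Gauss
  series to the whole cut plane in one step. The composition with the map is carried out on
  formal power series, which avoids any prior statement about convergence of the Gauss series.
\<close>

definition koebe_fps :: "complex fps" where
  "koebe_fps = 4 * fps_X * inverse (1 + fps_X) ^ 2"

lemma koebe_fps_nth_0 [simp]: "koebe_fps $ 0 = 0"
  by (simp add: koebe_fps_def)

lemma one_plus_fps_X_inverse [simp]: "(1 + fps_X :: complex fps) * inverse (1 + fps_X) = 1"
  by (rule inverse_mult_eq_1') simp

lemma one_minus_fps_X_inverse [simp]: "(1 - fps_X :: complex fps) * inverse (1 - fps_X) = 1"
  by (rule inverse_mult_eq_1') simp

lemma one_plus_fps_X_neq_0 [simp]: "(1 + fps_X :: complex fps) \<noteq> 0"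
  using one_plus_fps_X_inverse by fastforce

lemma koebe_fps_eq: "koebe_fps * (1 + fps_X) ^ 2 = 4 * fps_X"
proof -
  have "koebe_fps * (1 + fps_X) ^ 2 = 4 * fps_X * ((1 + fps_X) * inverse (1 + fps_X)) ^ 2"
    unfolding koebe_fps_def power_mult_distrib by (simp add: mult_ac)
  then show ?thesis by simp
qed

lemma fps_theta_koebe: "(1 + fps_X) * fps_theta koebe_fps = (1 - fps_X) * koebe_fps"
proof -
  let ?K = koebe_fps and ?X = "fps_X :: complex fps"
  have "fps_deriv (?K * (1 + ?X) ^ 2) = fps_deriv (4 * ?X)"
    by (simp only: koebe_fps_eq)
  then have deriv: "fps_deriv ?K * (1 + ?X) ^ 2 + 2 * ?K * (1 + ?X) = 4"
    by (simp add: fps_deriv_power algebra_simps power2_eq_square)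
  have "(1 + ?X) * ((1 + ?X) * fps_theta ?K)
      = ?X * (fps_deriv ?K * (1 + ?X) ^ 2 + 2 * ?K * (1 + ?X)) - 2 * ?X * ?K * (1 + ?X)"
    by (simp add: algebra_simps power2_eq_square)
  also have "\<dots> = 4 * ?X - 2 * ?X * ?K * (1 + ?X)"
    unfolding deriv by (simp only: mult.commute)
  also have "\<dots> = ?K * (1 + ?X) ^ 2 - 2 * ?X * ?K * (1 + ?X)"
    unfolding koebe_fps_eq ..
  also have "\<dots> = (1 + ?X) * ((1 - ?X) * ?K)"
    by (simp add: algebra_simps power2_eq_square)
  finally have "(1 + ?X) * ((1 + ?X) * fps_theta ?K) = (1 + ?X) * ((1 - ?X) * ?K)" .
  then show ?thesis by simp
qed

text \<open>
  The chain rule in the form \<theta>_z = (1+w)/(1-w) \<theta>_w.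
\<close>

lemma fps_theta_compose_koebe:
  "(1 + fps_X) * fps_theta (H oo koebe_fps) = (1 - fps_X) * (fps_theta H oo koebe_fps)"
proof -
  have 1: "fps_theta H oo koebe_fps = koebe_fps * (fps_deriv H oo koebe_fps)"
    by (simp add: fps_compose_mult_distrib)
  have 2: "fps_theta (H oo koebe_fps) = fps_theta koebe_fps * (fps_deriv H oo koebe_fps)"
    by (simp add: fps_compose_deriv mult_ac)
  show ?thesis unfolding 1 2 using fps_theta_koebe by algebra
qed

text \<open>
  The algebra behind the change of variable. Here D_1, D_2 stand for \<theta>_w G and
  \<theta>_w^2 G, and f_1, f_2 for \<theta>_z F and \<theta>_z^2 F in the variable w = X, while
  g_1 stands for \<theta>_w f_1. The claim is a linear combination of the four hypotheses.
\<close>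

lemma eliminate_koebe_intermediates:
  fixes X G D1 D2 f1 g1 f2 u s t :: "'a :: comm_ring_1"
  assumes f1: "(1 + X) * D1 = (1 - X) * f1"
    and f2: "(1 + X) * g1 = (1 - X) * f2"
    and D2: "X * D1 + (1 + X) * D2 = - X * f1 + (1 - X) * g1"
    and ode: "(1 + X) ^ 2 * (f2 + u * f1) = 4 * X * (f2 + s * f1 + t * G)"
  shows "(1 - X) * (1 + X) ^ 2 * D2 + (1 + X) * (2 * X + u * (1 + X) ^ 2 - 4 * s * X) * D1
           - 4 * t * X * (1 - X) * G = 0"
proof -
  have "(1 - X) * (1 + X) ^ 2 * D2 + (1 + X) * (2 * X + u * (1 + X) ^ 2 - 4 * s * X) * D1
           - 4 * t * X * (1 - X) * G
      = (1 - X) * (1 + X) * ((X * D1 + (1 + X) * D2) - (- X * f1 + (1 - X) * g1))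
        + (1 - X) ^ 2 * ((1 + X) * g1 - (1 - X) * f2)
        + (1 - X) * ((1 + X) ^ 2 * (f2 + u * f1) - 4 * X * (f2 + s * f1 + t * G))
        + (X * (1 + X) + u * (1 + X) ^ 2 - 4 * X * s) * ((1 + X) * D1 - (1 - X) * f1)"
    by (simp add: algebra_simps power2_eq_square)
  also have "\<dots> = 0" unfolding f1 f2 D2 ode by simp
  finally show ?thesis .
qed

lemma hyp2F1_koebe_ode:
  fixes a b c :: complex
  assumes "c \<notin> \<int>\<^sub>\<le>\<^sub>0"
  defines "G \<equiv> hyp2F1_fps a b c oo koebe_fps"
  shows "(1 - fps_X) * (1 + fps_X) ^ 2 * fps_theta (fps_theta G)
       + (1 + fps_X) * (2 * fps_X + fps_const (c - 1) * (1 + fps_X) ^ 2 - 4 * fps_const (a + b) * fps_X)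
           * fps_theta G
       - 4 * fps_const (a * b) * fps_X * (1 - fps_X) * G = 0"
proof -
  let ?X = "fps_X :: complex fps" and ?K = koebe_fps
  define F where "F = hyp2F1_fps a b c"
  define f1 where "f1 = fps_theta F oo ?K"
  define f2 where "f2 = fps_theta (fps_theta F) oo ?K"
  define c' where "c' = fps_const (c - 1)"
  define s where "s = fps_const (a + b)"
  define t where "t = fps_const (a * b)"
  have f1: "(1 + ?X) * fps_theta G = (1 - ?X) * f1"
    unfolding G_def f1_def F_def by (rule fps_theta_compose_koebe)
  have f2: "(1 + ?X) * fps_theta f1 = (1 - ?X) * f2"
    unfolding f2_def f1_def by (rule fps_theta_compose_koebe)
  have "(fps_theta (fps_theta F) + c' * fps_theta F) oo ?K
      = (?X * (fps_theta (fps_theta F) + s * fps_theta F + t * F)) oo ?K"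
    unfolding F_def c'_def s_def t_def by (simp only: hyp2F1_fps_ode[OF assms(1)])
  then have comp: "f2 + c' * f1 = ?K * (f2 + s * f1 + t * G)"
    unfolding f1_def f2_def G_def F_def c'_def s_def t_def
    by (simp add: fps_compose_add_distrib fps_compose_mult_distrib)
  have ode: "(1 + ?X) ^ 2 * (f2 + c' * f1) = 4 * ?X * (f2 + s * f1 + t * G)"
    unfolding comp koebe_fps_eq[symmetric] by (simp only: mult_ac)
  have "fps_theta ((1 + ?X) * fps_theta G) = fps_theta ((1 - ?X) * f1)"
    by (simp only: f1)
  then have D2: "?X * fps_theta G + (1 + ?X) * fps_theta (fps_theta G)
      = - ?X * f1 + (1 - ?X) * fps_theta f1"
    by (simp add: algebra_simps)
  show ?thesis
    unfolding c'_def[symmetric] s_def[symmetric] t_def[symmetric]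
    by (rule eliminate_koebe_intermediates[OF f1 f2 D2 ode])
qed

lemma conv_radius_hyp2F1_koebe:
  assumes "c \<notin> \<int>\<^sub>\<le>\<^sub>0"
  shows "fps_conv_radius (hyp2F1_fps a b c oo koebe_fps) \<ge> 1"
proof -
  let ?X = "fps_X :: complex fps"
  let ?G = "hyp2F1_fps a b c oo koebe_fps"
  let ?P = "(1 + ?X) * (2 * ?X + fps_const (c - 1) * (1 + ?X) ^ 2 - 4 * fps_const (a + b) * ?X)"
  let ?Q = "4 * fps_const (a * b) * ?X * (1 - ?X)"
  define J where "J = inverse (1 + ?X) ^ 2 * inverse (1 - ?X)"
  have "J * ((1 - ?X) * (1 + ?X) ^ 2)
      = ((1 + ?X) * inverse (1 + ?X)) ^ 2 * ((1 - ?X) * inverse (1 - ?X))"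
    unfolding J_def power_mult_distrib by (simp only: mult_ac)
  then have J: "J * ((1 - ?X) * (1 + ?X) ^ 2) = 1" by simp
  have distrib: "j * u * x + (j * v) * y + (j * (- w)) * z = j * (u * x + v * y - w * z)"
    for j u v w x y z :: "complex fps"
    by (simp add: algebra_simps)
  have "J * ((1 - ?X) * (1 + ?X) ^ 2) * fps_theta (fps_theta ?G) + (J * ?P) * fps_theta ?G
        + (J * (- ?Q)) * ?G = 0"
    using hyp2F1_koebe_ode[OF assms, of a b] unfolding distrib by simp
  then have "fps_theta (fps_theta ?G) + (J * ?P) * fps_theta ?G + (J * (- ?Q)) * ?G = 0"
    unfolding J by simp
  moreover have "fps_conv_radius (J * ?P) \<ge> 1"
  proof (rule holomorphic_on_imp_fps_conv_radius_ge)
    show "(\<lambda>z. (inverse (1 + z) ^ 2 * inverse (1 - z)) *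
             ((1 + z) * (2 * z + (c - 1) * (1 + z) ^ 2 - 4 * (a + b) * z))) has_fps_expansion J * ?P"
      unfolding J_def
      by (intro fps_expansion_intros) auto
    show "(\<lambda>z. (inverse (1 + z) ^ 2 * inverse (1 - z)) *
             ((1 + z) * (2 * z + (c - 1) * (1 + z) ^ 2 - 4 * (a + b) * z))) holomorphic_on eball 0 1"
      by (intro holomorphic_intros) (auto simp: add_eq_0_iff one_ereal_def)
  qed
  moreover have "fps_conv_radius (J * (- ?Q)) \<ge> 1"
  proof (rule holomorphic_on_imp_fps_conv_radius_ge)
    show "(\<lambda>z. (inverse (1 + z) ^ 2 * inverse (1 - z)) * (- (4 * (a * b) * z * (1 - z))))
            has_fps_expansion J * (- ?Q)"
      unfolding J_def
      by (intro fps_expansion_intros) auto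
    show "(\<lambda>z. (inverse (1 + z) ^ 2 * inverse (1 - z)) * (- (4 * (a * b) * z * (1 - z))))
            holomorphic_on eball 0 1"
      by (intro holomorphic_intros) (auto simp: add_eq_0_iff one_ereal_def)
  qed
  ultimately show ?thesis by (rule conv_radius_fuchsian)
qed

text \<open>
  The inverse of the Koebe-type map: with s = sqrt(1-z) one has 4w/(1+w)^2 = 1 - s^2 = z. On
  the cut plane the principal root has positive real part, which is what places w in the disc.
\<close>

definition koebe_inv :: "complex \<Rightarrow> complex" where
  "koebe_inv z = (1 - csqrt (1 - z)) / (1 + csqrt (1 - z))"

lemma open_slit_plane: "open slit_plane"
proof -
  have "closed (complex_of_real ` {1..})"
  proof -
    have "complex_of_real ` {1..} = {z. Re z \<ge> 1} \<inter> {z. Im z = 0}"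
      by (auto simp: complex_eq_iff image_iff)
    then show ?thesis
      by (auto intro!: closed_Int closed_halfspace_Re_ge closed_halfspace_Im_eq)
  qed
  then show ?thesis unfolding slit_plane_def by (rule open_Compl)
qed

lemma one_minus_slit_plane_notin_nonpos_Reals: "z \<in> slit_plane \<Longrightarrow> 1 - z \<notin> \<real>\<^sub>\<le>\<^sub>0"
proof
  assume "z \<in> slit_plane" "1 - z \<in> \<real>\<^sub>\<le>\<^sub>0"
  then obtain x where "x \<le> 0" "1 - z = of_real x" by (auto elim!: nonpos_Reals_cases)
  then have "z = of_real (1 - x)" "1 - x \<ge> 1" by (auto simp: algebra_simps)
  with \<open>z \<in> slit_plane\<close> show False unfolding slit_plane_def by blast
qed

lemma ball_subset_slit_plane: "ball 0 1 \<subseteq> slit_plane"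
  by (auto simp: slit_plane_def)

lemma Re_csqrt_slit_plane: "z \<in> slit_plane \<Longrightarrow> Re (csqrt (1 - z)) > 0"
proof -
  assume "z \<in> slit_plane"
  then have *: "1 - z \<notin> \<real>\<^sub>\<le>\<^sub>0" by (rule one_minus_slit_plane_notin_nonpos_Reals)
  have "Re (csqrt (1 - z)) \<noteq> 0"
  proof
    assume "Re (csqrt (1 - z)) = 0"
    then have "Re (csqrt (1 - z) ^ 2) \<le> 0" "Im (csqrt (1 - z) ^ 2) = 0"
      unfolding power2_eq_square by simp_all
    with * show False unfolding complex_nonpos_Reals_iff by simp
  qed
  with csqrt_principal[of "1 - z"] show ?thesis by linarith
qed

lemma one_plus_csqrt_neq_0: "z \<in> slit_plane \<Longrightarrow> 1 + csqrt (1 - z) \<noteq> 0"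
proof
  assume "z \<in> slit_plane" and eq: "1 + csqrt (1 - z) = 0"
  then have "Re 1 + Re (csqrt (1 - z)) > 0"
    using Re_csqrt_slit_plane by (intro add_pos_pos) simp_all
  then show False unfolding plus_complex.sel(1)[symmetric] eq by simp
qed

lemma norm_koebe_inv_less_1:
  assumes "z \<in> slit_plane"
  shows "norm (koebe_inv z) < 1"
proof -
  define s where "s = csqrt (1 - z)"
  have s: "Re s > 0" using Re_csqrt_slit_plane[OF assms] by (simp add: s_def)
  have "norm (1 - s) ^ 2 < norm (1 + s) ^ 2"
    using s unfolding cmod_power2 by (simp add: power2_eq_square algebra_simps)
  then have "norm (1 - s) < norm (1 + s)" by (rule power2_less_imp_less) simp
  moreover have "norm (1 + s) > 0" using s by (auto simp: complex_eq_iff)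
  ultimately show ?thesis by (simp add: koebe_inv_def norm_divide flip: s_def)
qed

lemma holomorphic_koebe_inv: "koebe_inv holomorphic_on slit_plane"
  unfolding koebe_inv_def
proof (intro holomorphic_intros)
  fix z assume z: "z \<in> slit_plane"
  show "1 - z \<notin> \<real>\<^sub>\<le>\<^sub>0" using z by (rule one_minus_slit_plane_notin_nonpos_Reals)
  show "1 + csqrt (1 - z) \<noteq> 0" using z by (rule one_plus_csqrt_neq_0)
qed (auto simp: one_minus_slit_plane_notin_nonpos_Reals)

lemma koebe_inv_eq:
  assumes "z \<in> slit_plane"
  shows "koebe_inv z * 4 * inverse (1 + koebe_inv z) ^ 2 = z"
proof -
  define s where "s = csqrt (1 - z)"
  have s: "1 + s \<noteq> 0" using one_plus_csqrt_neq_0[OF assms] by (simp add: s_def)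
  have w: "koebe_inv z = (1 - s) / (1 + s)" by (simp add: koebe_inv_def s_def)
  have "1 + koebe_inv z = 2 / (1 + s)"
    unfolding w using s by (simp add: divide_simps)
  then have "koebe_inv z * 4 * inverse (1 + koebe_inv z) ^ 2
      = (1 - s) / (1 + s) * 4 * ((1 + s) / 2) ^ 2"
    unfolding w by simp
  also have "\<dots> = (1 - s) * (1 + s)"
    using s by (simp add: power2_eq_square divide_simps)
  also have "\<dots> = 1 - s ^ 2" by (simp add: power2_eq_square algebra_simps)
  also have "\<dots> = z" by (simp add: s_def)
  finally show ?thesis .
qed

text \<open>
  The continuation is G(w(z)), where G is the Gauss series composed with the Koebe-type series.
  Near 0 it is again the Gauss series, because the two changes of variable are inverse to
  each other as formal power series.
\<close>

lemma hyp2F1_continuation_exists: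
  assumes "c \<notin> \<int>\<^sub>\<le>\<^sub>0"
  shows "\<exists>f. f holomorphic_on slit_plane \<and> f has_fps_expansion hyp2F1_fps a b c"
proof -
  define F where "F = hyp2F1_fps a b c"
  define G where "G = F oo koebe_fps"
  have G: "fps_conv_radius G \<ge> 1"
    unfolding G_def F_def by (rule conv_radius_hyp2F1_koebe[OF assms])
  have "koebe_inv holomorphic_on ball 0 1"
    using holomorphic_koebe_inv ball_subset_slit_plane by (rule holomorphic_on_subset)
  then have W: "koebe_inv has_fps_expansion fps_expansion koebe_inv 0"
    by (rule has_fps_expansion_fps_expansion[OF open_ball, rotated]) simp
  define W where "W = fps_expansion koebe_inv 0"
  note W = W[folded W_def]
  have W0: "W $ 0 = 0"
    using has_fps_expansion_imp_0_eq_fps_nth_0[OF W] by (simp add: koebe_inv_def)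
  have "koebe_fps oo W = fps_X"
  proof (rule fps_expansion_unique_complex)
    have "(\<lambda>w. 4 * w * inverse (1 + w) ^ 2) has_fps_expansion koebe_fps"
      unfolding koebe_fps_def by (intro fps_expansion_intros) auto
    from has_fps_expansion_compose[OF this W W0]
    show "(\<lambda>z. 4 * koebe_inv z * inverse (1 + koebe_inv z) ^ 2) has_fps_expansion (koebe_fps oo W)"
      by (simp add: o_def)
    have "eventually (\<lambda>z. z \<in> ball 0 1) (nhds (0 :: complex))"
      by (intro eventually_nhds_in_open) auto
    then have "eventually (\<lambda>z. 4 * koebe_inv z * inverse (1 + koebe_inv z) ^ 2 = z) (nhds 0)"
    proof eventually_elim
      case (elim z)
      then have "z \<in> slit_plane" using ball_subset_slit_plane by blast
      from koebe_inv_eq[OF this] show ?case by (simp only: mult_ac)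
    qed
    then have "(\<lambda>z. 4 * koebe_inv z * inverse (1 + koebe_inv z) ^ 2) has_fps_expansion fps_X
        \<longleftrightarrow> (\<lambda>z. z) has_fps_expansion (fps_X :: complex fps)"
      by (rule has_fps_expansion_cong[OF _ refl])
    then show "(\<lambda>z. 4 * koebe_inv z * inverse (1 + koebe_inv z) ^ 2) has_fps_expansion fps_X"
      using has_fps_expansion_fps_X by (rule iffD2)
  qed
  then have GW: "G oo W = F"
    unfolding G_def using fps_compose_assoc[OF W0 koebe_fps_nth_0, of F] by simp
  have "eval_fps G has_fps_expansion G"
    by (intro eval_fps_has_fps_expansion) (rule less_le_trans[OF _ G], simp)
  from has_fps_expansion_compose[OF this W W0]
  have "(eval_fps G \<circ> koebe_inv) has_fps_expansion F" by (simp add: GW)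
  moreover have "(eval_fps G \<circ> koebe_inv) holomorphic_on slit_plane"
  proof (rule holomorphic_on_compose_gen[OF holomorphic_koebe_inv])
    show "eval_fps G holomorphic_on ball 0 1"
    proof (rule holomorphic_on_eval_fps)
      show "ball 0 1 \<subseteq> eball 0 (fps_conv_radius G)"
        using G by (intro ball_eball_mono) (simp add: one_ereal_def)
    qed
    show "koebe_inv ` slit_plane \<subseteq> ball 0 1"
      using norm_koebe_inv_less_1 by auto
  qed
  ultimately show ?thesis unfolding F_def by blast
qed

text \<open>
  Existence of a continuation makes the choice in the definition of \<^const>\<open>hyp2F1\<close>
  effective.
\<close>

lemma hyp2F1_spec:
  assumes "c \<notin> \<int>\<^sub>\<le>\<^sub>0"
  shows "hyp2F1 a b c holomorphic_on slit_plane"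
    and "norm z < 1 \<Longrightarrow> (\<lambda>n. hyp2F1_coeff a b c n * z ^ n) sums hyp2F1 a b c z"
proof -
  obtain f where f: "f holomorphic_on slit_plane" "f has_fps_expansion hyp2F1_fps a b c"
    using hyp2F1_continuation_exists[OF assms] by blast
  have "f holomorphic_on eball 0 (ereal 1)"
    using f(1) ball_subset_slit_plane holomorphic_on_subset by auto
  then have "(\<lambda>n. hyp2F1_fps a b c $ n * z ^ n) sums f z" if "norm z < 1" for z
    using has_fps_expansion_imp_sums_complex[OF f(2), of "ereal 1" z] that by auto
  then have "\<exists>f. f holomorphic_on slit_plane \<and>
      (\<forall>z. norm z < 1 \<longrightarrow> (\<lambda>n. hyp2F1_coeff a b c n * z ^ n) sums f z)"
    using f(1) by auto
  from someI_ex[OF this]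
  show "hyp2F1 a b c holomorphic_on slit_plane"
    and "norm z < 1 \<Longrightarrow> (\<lambda>n. hyp2F1_coeff a b c n * z ^ n) sums hyp2F1 a b c z"
    unfolding hyp2F1_def by auto
qed

section \<open>Growth of the coefficients\<close>

text \<open>
  Euler's limit for 1/\<Gamma>, applied to each of the four factors; the factorials cancel and
  the powers of n combine to n^(c+d-a-b). The case d = 1 describes the Gauss coefficients,
  a real d compares them with a binomial series, and the case c + d = a + b evaluates the infinite
  product in Gauss's summation theorem.
\<close>

lemma pochhammer_ratio_asymptotics:
  fixes a b c d :: complex
  assumes "c \<notin> \<int>\<^sub>\<le>\<^sub>0" "d \<notin> \<int>\<^sub>\<le>\<^sub>0"
  shows "(\<lambda>n. pochhammer a (Suc n) * pochhammer b (Suc n) / (pochhammer c (Suc n) * pochhammer d (Suc n))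
             * exp ((c + d - a - b) * of_real (ln (of_nat n))))
          \<longlonglongrightarrow> rGamma a * rGamma b / (rGamma c * rGamma d)"
proof -
  have "(\<lambda>n. rGamma_series a n * rGamma_series b n / (rGamma_series c n * rGamma_series d n))
          \<longlonglongrightarrow> rGamma a * rGamma b / (rGamma c * rGamma d)"
    by (intro tendsto_intros) (use assms in \<open>simp add: rGamma_eq_zero_iff\<close>)
  also have "(\<lambda>n. rGamma_series a n * rGamma_series b n / (rGamma_series c n * rGamma_series d n))
     = (\<lambda>n. pochhammer a (Suc n) * pochhammer b (Suc n) / (pochhammer c (Suc n) * pochhammer d (Suc n))
             * exp ((c + d - a - b) * of_real (ln (of_nat n))))"
  proof
    fix n
    define L :: complex where "L = of_real (ln (of_nat n))"
    have "exp ((c + d - a - b) * L) = exp (c * L) * exp (d * L) / (exp (a * L) * exp (b * L))"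
      by (simp add: algebra_simps exp_add exp_diff)
    then show "rGamma_series a n * rGamma_series b n / (rGamma_series c n * rGamma_series d n)
       = pochhammer a (Suc n) * pochhammer b (Suc n) / (pochhammer c (Suc n) * pochhammer d (Suc n))
             * exp ((c + d - a - b) * of_real (ln (of_nat n)))"
      unfolding rGamma_series_def L_def[symmetric] by (simp add: mult_ac)
  qed
  finally show ?thesis .
qed

lemma pochhammer_ratio_bound:
  fixes a b c d :: complex
  assumes "c \<notin> \<int>\<^sub>\<le>\<^sub>0" "d \<notin> \<int>\<^sub>\<le>\<^sub>0"
  obtains K where "K > 0"
    "\<And>n. n > 0 \<Longrightarrow> norm (pochhammer a (Suc n) * pochhammer b (Suc n) / (pochhammer c (Suc n) * pochhammer d (Suc n)))
             \<le> K * real n powr (Re (a + b - c - d))"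
proof -
  have "Bseq (\<lambda>n. pochhammer a (Suc n) * pochhammer b (Suc n) / (pochhammer c (Suc n) * pochhammer d (Suc n))
             * exp ((c + d - a - b) * of_real (ln (of_nat n))))"
    using pochhammer_ratio_asymptotics[OF assms] convergentI convergent_imp_Bseq by blast
  then obtain K where "K > 0" and K: "\<And>n. norm (pochhammer a (Suc n) * pochhammer b (Suc n) / (pochhammer c (Suc n) * pochhammer d (Suc n))
             * exp ((c + d - a - b) * of_real (ln (of_nat n)))) \<le> K"
    by (elim BseqE) auto
  show ?thesis
  proof (rule that[OF \<open>K > 0\<close>])
    fix n :: nat assume n: "n > 0"
    let ?r = "pochhammer a (Suc n) * pochhammer b (Suc n) / (pochhammer c (Suc n) * pochhammer d (Suc n))"
    have "norm (exp ((c + d - a - b) * of_real (ln (of_nat n)))) = real n powr (Re (c + d - a - b))"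
      using n by (simp add: powr_def mult_ac)
    also have "Re (c + d - a - b) = - Re (a + b - c - d)" by simp
    also have "real n powr \<dots> = inverse (real n powr (Re (a + b - c - d)))"
      by (rule powr_minus)
    finally have "norm ?r * inverse (real n powr (Re (a + b - c - d))) \<le> K"
      using K[of n] by (simp only: norm_mult)
    then show "norm ?r \<le> K * real n powr (Re (a + b - c - d))"
      using n by (simp add: field_simps)
  qed
qed

lemma one_notin_nonpos_Ints: "(1 :: complex) \<notin> \<int>\<^sub>\<le>\<^sub>0"
  by simp

lemma Re_pos_notin_nonpos_Ints: "Re z > 0 \<Longrightarrow> z \<notin> \<int>\<^sub>\<le>\<^sub>0"
  by (auto elim!: nonpos_Ints_cases)

lemma hyp2F1_coeff_bound:
  assumes "c \<notin> \<int>\<^sub>\<le>\<^sub>0"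
  obtains K where "K > 0"
    "\<And>n. n > 0 \<Longrightarrow> norm (hyp2F1_coeff a b c (Suc n)) \<le> K * real n powr (Re (a + b - c) - 1)"
proof -
  obtain K where "K > 0" and
    K: "\<And>n. n > 0 \<Longrightarrow> norm (pochhammer a (Suc n) * pochhammer b (Suc n) / (pochhammer c (Suc n) * pochhammer 1 (Suc n)))
             \<le> K * real n powr (Re (a + b - c - 1))"
    by (rule pochhammer_ratio_bound[OF assms one_notin_nonpos_Ints, where a = a and b = b]) (rule that)
  show ?thesis
  proof (rule that[OF \<open>K > 0\<close>])
    fix n :: nat assume "n > 0"
    from K[OF this] show "norm (hyp2F1_coeff a b c (Suc n)) \<le> K * real n powr (Re (a + b - c) - 1)"
      unfolding hyp2F1_coeff_def pochhammer_fact by simp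
  qed
qed

lemma summable_norm_hyp2F1_coeff:
  assumes "c \<notin> \<int>\<^sub>\<le>\<^sub>0" "Re (c - a - b) > 0"
  shows "summable (\<lambda>n. norm (hyp2F1_coeff a b c n))"
proof -
  obtain K where K: "\<And>n. n > 0 \<Longrightarrow> norm (hyp2F1_coeff a b c (Suc n)) \<le> K * real n powr (Re (a + b - c) - 1)"
    using hyp2F1_coeff_bound[OF assms(1)] by metis
  have "summable (\<lambda>n. norm (hyp2F1_coeff a b c (Suc n)))"
  proof (rule summable_comparison_test'[where N = 1])
    show "summable (\<lambda>n. K * real n powr (Re (a + b - c) - 1))"
      using assms(2) by (intro summable_mult) (simp add: summable_real_powr_iff)
  qed (use K in auto)
  then show ?thesis using summable_Suc_iff[of "\<lambda>n. norm (hyp2F1_coeff a b c n)"] by blast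
qed

lemma n_hyp2F1_coeff_tendsto_0:
  assumes "c \<notin> \<int>\<^sub>\<le>\<^sub>0" "Re (c - a - b) > 0"
  shows "(\<lambda>n. of_nat n * hyp2F1_coeff a b c n) \<longlonglongrightarrow> 0"
proof -
  obtain K where K: "\<And>n. n > 0 \<Longrightarrow> norm (hyp2F1_coeff a b c (Suc n)) \<le> K * real n powr (Re (a + b - c) - 1)"
    using hyp2F1_coeff_bound[OF assms(1)] by metis
  have *: "(\<lambda>n. of_nat n * hyp2F1_coeff a b c (Suc n)) \<longlonglongrightarrow> 0"
  proof (rule Lim_null_comparison)
    show "eventually (\<lambda>n. norm (of_nat n * hyp2F1_coeff a b c (Suc n)) \<le> K * real n powr (Re (a + b - c))) sequentially"
      using eventually_gt_at_top[of 0]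
    proof eventually_elim
      case (elim n)
      have "norm (of_nat n * hyp2F1_coeff a b c (Suc n)) \<le> real n * (K * real n powr (Re (a + b - c) - 1))"
        using K[OF elim] by (simp add: norm_mult mult_left_mono)
      also have "\<dots> = K * real n powr (Re (a + b - c))"
        using elim by (simp add: powr_diff)
      finally show ?case .
    qed
    have "(\<lambda>n. real n powr (Re (a + b - c))) \<longlonglongrightarrow> 0"
      using assms(2) by (intro tendsto_neg_powr filterlim_real_sequentially) simp
    then show "(\<lambda>n. K * real n powr (Re (a + b - c))) \<longlonglongrightarrow> 0"
      by (rule tendsto_mult_right_zero)
  qed
  have "summable (\<lambda>n. hyp2F1_coeff a b c n)"
    using summable_norm_hyp2F1_coeff[OF assms] by (rule summable_norm_cancel)
  then have "(\<lambda>n. hyp2F1_coeff a b c (Suc n)) \<longlonglongrightarrow> 0"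
    by (intro LIMSEQ_Suc summable_LIMSEQ_zero)
  from tendsto_add[OF * this]
  have "(\<lambda>n. of_nat (Suc n) * hyp2F1_coeff a b c (Suc n)) \<longlonglongrightarrow> 0"
    by (simp add: algebra_simps)
  then show ?thesis by (rule LIMSEQ_imp_Suc)
qed

section \<open>Gauss's summation theorem\<close>

lemma plus_one_notin_nonpos_Ints: "c \<notin> \<int>\<^sub>\<le>\<^sub>0 \<Longrightarrow> c + 1 \<notin> (\<int>\<^sub>\<le>\<^sub>0 :: complex set)"
  using plus_one_in_nonpos_Ints_imp by blast

text \<open>
  Coefficient form of
  (1-z) F'(a,b;c;z) + (c-a-b) F(a,b;c;z) = (c-a)(c-b)/c F(a,b;c+1;z). It serves
  twice: its left-hand side telescopes at z = 1, which gives Gauss's theorem, and the same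
  left-hand side is what remains of the boundary term at x = 1.
\<close>

lemma hyp2F1_coeff_contiguous:
  assumes c: "c \<notin> \<int>\<^sub>\<le>\<^sub>0"
  shows "of_nat (Suc n) * hyp2F1_coeff a b c (Suc n) - of_nat n * hyp2F1_coeff a b c n
           + (c - a - b) * hyp2F1_coeff a b c n
         = (c - a) * (c - b) / c * hyp2F1_coeff a b (c + 1) n"
proof -
  have nz: "c \<noteq> 0" "c + of_nat n \<noteq> 0"
    using c nonpos_Int_add_of_nat_neq_0[of c] nonpos_Int_add_of_nat_neq_0[of c 0] by auto
  have "c * pochhammer (c + 1) n = pochhammer c n * (c + of_nat n)"
    by (metis pochhammer_rec pochhammer_Suc)
  then have p: "pochhammer (c + 1) n = pochhammer c n * ((c + of_nat n) / c)"
    using nz by (simp add: field_simps)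
  have shift: "hyp2F1_coeff a b (c + 1) n = c / (c + of_nat n) * hyp2F1_coeff a b c n"
    unfolding hyp2F1_coeff_def p by (simp add: mult_ac)
  have step: "of_nat (Suc n) * hyp2F1_coeff a b c (Suc n)
      = (a + of_nat n) * (b + of_nat n) / (c + of_nat n) * hyp2F1_coeff a b c n"
    using hyp2F1_coeff_Suc[OF c, of n a b] nz by (simp add: field_simps)
  have "of_nat (Suc n) * hyp2F1_coeff a b c (Suc n) - of_nat n * hyp2F1_coeff a b c n
           + (c - a - b) * hyp2F1_coeff a b c n
      = ((a + of_nat n) * (b + of_nat n) / (c + of_nat n) + (c - a - b - of_nat n)) * hyp2F1_coeff a b c n"
    unfolding step by (simp add: algebra_simps)
  also have "(a + of_nat n) * (b + of_nat n) / (c + of_nat n) + (c - a - b - of_nat n)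
      = (c - a) * (c - b) / (c + of_nat n)"
    using nz(2) by (simp add: field_simps)
  finally show ?thesis unfolding shift using nz(1) by simp
qed

lemma suminf_hyp2F1_coeff_contiguous:
  assumes c: "c \<notin> \<int>\<^sub>\<le>\<^sub>0" and re: "Re (c - a - b) > 0"
  shows "(c - a - b) * (\<Sum>n. hyp2F1_coeff a b c n)
           = (c - a) * (c - b) / c * (\<Sum>n. hyp2F1_coeff a b (c + 1) n)"
proof -
  have summ: "summable (hyp2F1_coeff a b c)" "summable (hyp2F1_coeff a b (c + 1))"
    using summable_norm_hyp2F1_coeff[OF c re]
      summable_norm_hyp2F1_coeff[OF plus_one_notin_nonpos_Ints[OF c], of a b] re
    by (auto intro!: summable_norm_cancel)
  have "(\<lambda>n. of_nat (Suc n) * hyp2F1_coeff a b c (Suc n) - of_nat n * hyp2F1_coeff a b c n) sums (0 - 0)"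
    using telescope_sums[OF n_hyp2F1_coeff_tendsto_0[OF c re]] by simp
  from sums_add[OF this sums_mult[OF summable_sums[OF summ(1)], of "c - a - b"]]
  have "(\<lambda>n. (c - a) * (c - b) / c * hyp2F1_coeff a b (c + 1) n)
          sums ((c - a - b) * (\<Sum>n. hyp2F1_coeff a b c n))"
    by (simp only: hyp2F1_coeff_contiguous[OF c] diff_zero add_0_left)
  moreover have "(\<lambda>n. (c - a) * (c - b) / c * hyp2F1_coeff a b (c + 1) n)
          sums ((c - a) * (c - b) / c * (\<Sum>n. hyp2F1_coeff a b (c + 1) n))"
    by (intro sums_mult summable_sums summ)
  ultimately show ?thesis by (rule sums_unique2)
qed

lemma add_of_nat_notin_nonpos_Ints: "c \<notin> \<int>\<^sub>\<le>\<^sub>0 \<Longrightarrow> c + of_nat k \<notin> (\<int>\<^sub>\<le>\<^sub>0 :: complex set)"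
proof (induction k)
  case (Suc k)
  then show ?case using plus_one_notin_nonpos_Ints[of "c + of_nat k"] by (simp add: add_ac)
qed simp

lemma suminf_hyp2F1_coeff_iterate:
  assumes c: "c \<notin> \<int>\<^sub>\<le>\<^sub>0" and re: "Re (c - a - b) > 0"
  shows "(\<Sum>n. hyp2F1_coeff a b c n)
           = pochhammer (c - a) k * pochhammer (c - b) k / (pochhammer c k * pochhammer (c - a - b) k)
             * (\<Sum>n. hyp2F1_coeff a b (c + of_nat k) n)"
proof (induction k)
  case (Suc k)
  let ?c = "c + of_nat k"
  have re': "Re (?c - a - b) > 0" using re by simp
  then have nz: "?c - a - b \<noteq> 0" "?c \<noteq> 0"
    using nonpos_Int_add_of_nat_neq_0[OF c] by (auto simp: complex_eq_iff)
  have solve: "S = x * y / (z * w) * T" if "w * S = x * y / z * T" "w \<noteq> 0" "z \<noteq> 0"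
    for x y z w S T :: complex
    using that by (simp add: field_simps)
  have "(\<Sum>n. hyp2F1_coeff a b ?c n)
      = (?c - a) * (?c - b) / (?c * (?c - a - b)) * (\<Sum>n. hyp2F1_coeff a b (?c + 1) n)"
    by (rule solve[OF suminf_hyp2F1_coeff_contiguous[OF add_of_nat_notin_nonpos_Ints[OF c] re'] nz])
  moreover have "?c - a = c - a + of_nat k" "?c - b = c - b + of_nat k"
    "?c - a - b = c - a - b + of_nat k" "?c + 1 = c + of_nat (Suc k)"
    by simp_all
  ultimately have "(\<Sum>n. hyp2F1_coeff a b ?c n)
      = (c - a + of_nat k) * (c - b + of_nat k) / (?c * (c - a - b + of_nat k))
        * (\<Sum>n. hyp2F1_coeff a b (c + of_nat (Suc k)) n)"
    by (simp only:)
  with Suc show ?case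
    by (simp only: pochhammer_Suc) (simp add: mult_ac)
qed simp

text \<open>
  A majorant that is uniform in c on a half-plane, as needed to let c tend to infinity under
  the sum.
\<close>

lemma norm_hyp2F1_coeff_mono:
  assumes "A \<ge> norm a" "B \<ge> norm b" "R \<le> Re c" "R > 0"
  shows "norm (hyp2F1_coeff a b c n) \<le> norm (hyp2F1_coeff (of_real A) (of_real B) (of_real R) n)"
proof (induction n)
  case 0
  show ?case by (simp add: hyp2F1_coeff_def)
next
  case (Suc n)
  have A0: "A \<ge> 0" "B \<ge> 0" using assms(1,2) norm_ge_zero order.trans by blast+
  have step: "hyp2F1_coeff x y w (Suc n)
      = (x + of_nat n) * (y + of_nat n) / ((w + of_nat n) * (1 + of_nat n)) * hyp2F1_coeff x y w n" for x y w
    unfolding hyp2F1_coeff_def by (simp add: pochhammer_Suc mult_ac)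
  have 1: "norm (a + of_nat n) \<le> A + real n"
    using norm_triangle_ineq[of a "of_nat n"] assms(1) by simp
  have 2: "norm (b + of_nat n) \<le> B + real n"
    using norm_triangle_ineq[of b "of_nat n"] assms(2) by simp
  have 3: "norm (c + of_nat n) \<ge> R + real n"
    using complex_Re_le_cmod[of "c + of_nat n"] assms(3) by simp
  have eq: "norm (complex_of_real x + of_nat n) = x + real n" if "x \<ge> 0" for x
    using that by (metis abs_of_nonneg add_nonneg_nonneg norm_of_real of_nat_0_le_iff of_real_add of_real_of_nat_eq)
  have "norm (hyp2F1_coeff a b c (Suc n))
      = norm (a + of_nat n) * norm (b + of_nat n) / (norm (c + of_nat n) * norm (1 + of_nat n :: complex))
        * norm (hyp2F1_coeff a b c n)"
    unfolding step norm_mult norm_divide ..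
  also have "\<dots> \<le> (A + real n) * (B + real n) / ((R + real n) * norm (1 + of_nat n :: complex))
        * norm (hyp2F1_coeff (of_real A) (of_real B) (of_real R) n)"
    using 1 2 3 Suc A0 assms(4)
    by (intro mult_mono frac_le mult_nonneg_nonneg divide_nonneg_nonneg mult_pos_pos)
       (auto simp flip: of_nat_Suc)
  also have "\<dots> = norm (hyp2F1_coeff (of_real A) (of_real B) (of_real R) (Suc n))"
    unfolding step norm_mult norm_divide using A0 assms(4) by (simp add: eq)
  finally show ?case .
qed

lemma hyp2F1_coeff_tendsto:
  "(\<lambda>k. hyp2F1_coeff a b (c + of_nat k) n) \<longlonglongrightarrow> (if n = 0 then 1 else 0)"
proof (induction n)
  case 0
  show ?case by (simp add: hyp2F1_coeff_def)
next
  case (Suc n)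
  have "filterlim (\<lambda>k. (c + of_nat n) + (of_nat k :: complex)) at_infinity sequentially"
    by (intro tendsto_add_filterlim_at_infinity[OF tendsto_const] tendsto_of_nat)
  then have "(\<lambda>k. inverse ((c + of_nat n) + (of_nat k :: complex))) \<longlonglongrightarrow> 0"
    by (rule filterlim_compose[OF tendsto_inverse_0])
  from tendsto_mult[OF tendsto_mult[OF Suc this] tendsto_const[of "(a + of_nat n) * (b + of_nat n) / (1 + of_nat n)"]]
  have "(\<lambda>k. hyp2F1_coeff a b (c + of_nat k) n * inverse ((c + of_nat n) + of_nat k)
          * ((a + of_nat n) * (b + of_nat n) / (1 + of_nat n))) \<longlonglongrightarrow> 0"
    by simp
  moreover have "hyp2F1_coeff a b (c + of_nat k) n * inverse ((c + of_nat n) + of_nat k)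
          * ((a + of_nat n) * (b + of_nat n) / (1 + of_nat n)) = hyp2F1_coeff a b (c + of_nat k) (Suc n)" for k
    unfolding hyp2F1_coeff_def by (simp add: pochhammer_Suc divide_inverse mult_ac add_ac)
  ultimately show ?case by simp
qed

lemma suminf_hyp2F1_coeff_tendsto_1:
  "(\<lambda>k. \<Sum>n. hyp2F1_coeff a b (c + of_nat k) n) \<longlonglongrightarrow> 1"
proof -
  define R where "R = norm a + norm b + 1"
  have R: "R > 0" by (simp add: R_def add_nonneg_pos)
  define M where "M n = norm (hyp2F1_coeff (of_real (norm a)) (of_real (norm b)) (of_real R) n)" for n
  have "summable M"
    unfolding M_def using R
    by (intro summable_norm_hyp2F1_coeff Re_pos_notin_nonpos_Ints) (auto simp: R_def)
  define N where "N = nat \<lceil>R - Re c\<rceil>"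
  have "\<forall>n\<ge>N. \<forall>k\<ge>N. norm (hyp2F1_coeff a b (c + of_nat k) n) \<le> M n"
  proof (intro allI impI)
    fix n k assume "k \<ge> N"
    then have "R \<le> Re (c + of_nat k)" unfolding N_def by simp
    then show "norm (hyp2F1_coeff a b (c + of_nat k) n) \<le> M n"
      unfolding M_def using R by (intro norm_hyp2F1_coeff_mono) auto
  qed
  then have "eventually (\<lambda>(n, k). norm (hyp2F1_coeff a b (c + of_nat k) n) \<le> M n)
               (sequentially \<times>\<^sub>F sequentially)"
    unfolding eventually_prod_sequentially by (intro exI[of _ N]) auto
  from tannerys_theorem[OF hyp2F1_coeff_tendsto this \<open>summable M\<close>]
  have "(\<lambda>k. \<Sum>n. hyp2F1_coeff a b (c + of_nat k) n) \<longlonglongrightarrow> (\<Sum>n. if n = 0 then 1 else 0)"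
    by simp
  also have "(\<Sum>n. if n = 0 then 1 else 0 :: complex) = (\<Sum>n\<in>{0::nat}. 1)"
    by (subst suminf_finite[of "{0}"]) auto
  finally show ?thesis by simp
qed

text \<open>
  The sum is unchanged when c is raised to c + k at the price of a quotient of Pochhammer
  symbols. As k tends to infinity the sum tends to 1, and the quotient tends to the
  quotient of Gamma values by Euler's limit.
\<close>

theorem gauss_summation:
  assumes c: "c \<notin> \<int>\<^sub>\<le>\<^sub>0" and re: "Re (c - a - b) > 0"
  shows "(\<Sum>n. hyp2F1_coeff a b c n) = Gamma c * Gamma (c - a - b) * rGamma (c - a) * rGamma (c - b)"
proof -
  have "(\<lambda>k. pochhammer (c - a) (Suc k) * pochhammer (c - b) (Suc k)
               / (pochhammer c (Suc k) * pochhammer (c - a - b) (Suc k)))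
        \<longlonglongrightarrow> rGamma (c - a) * rGamma (c - b) / (rGamma c * rGamma (c - a - b))"
    using pochhammer_ratio_asymptotics[OF c Re_pos_notin_nonpos_Ints[OF re], of "c - a" "c - b"]
    by simp
  from tendsto_mult[OF this LIMSEQ_Suc[OF suminf_hyp2F1_coeff_tendsto_1[of a b c]]]
  have "(\<lambda>k. \<Sum>n. hyp2F1_coeff a b c n) \<longlonglongrightarrow>
          rGamma (c - a) * rGamma (c - b) / (rGamma c * rGamma (c - a - b))"
    by (simp only: suminf_hyp2F1_coeff_iterate[OF c re, symmetric] mult_1_right)
  then have "(\<Sum>n. hyp2F1_coeff a b c n)
      = rGamma (c - a) * rGamma (c - b) / (rGamma c * rGamma (c - a - b))"
    using LIMSEQ_unique tendsto_const by blast
  then show ?thesis by (simp add: rGamma_inverse_Gamma field_simps)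
qed

section \<open>Differential relations on the unit disc\<close>

lemma hyp2F1_has_fps_expansion:
  assumes "c \<notin> \<int>\<^sub>\<le>\<^sub>0"
  shows "hyp2F1 a b c has_fps_expansion hyp2F1_fps a b c"
proof (rule has_fps_expansionI)
  have "eventually (\<lambda>z. z \<in> ball 0 1) (nhds (0 :: complex))"
    by (intro eventually_nhds_in_open) auto
  then show "eventually (\<lambda>z. (\<lambda>n. hyp2F1_fps a b c $ n * z ^ n) sums hyp2F1 a b c z) (nhds 0)"
    by eventually_elim (simp add: hyp2F1_spec(2)[OF assms])
qed

lemma holomorphic_deriv_hyp2F1:
  assumes "c \<notin> \<int>\<^sub>\<le>\<^sub>0"
  shows "deriv (hyp2F1 a b c) holomorphic_on slit_plane"
  by (intro holomorphic_deriv hyp2F1_spec(1) assms open_slit_plane)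

text \<open>
  The bridge from identities of formal power series to identities of functions.
\<close>

lemma has_fps_expansion_0_imp_eq_0:
  assumes "f has_fps_expansion 0" "f holomorphic_on slit_plane" "norm z < 1"
  shows "f z = 0"
proof -
  have "f holomorphic_on ball 0 1"
    using assms(2) ball_subset_slit_plane by (rule holomorphic_on_subset)
  from has_fps_expansion_imp_eval_fps_eq[OF assms(1,3) this] show ?thesis by simp
qed

lemma hyp2F1_fps_ode_second_order:
  fixes a b c :: complex
  assumes "c \<notin> \<int>\<^sub>\<le>\<^sub>0"
  defines "F \<equiv> hyp2F1_fps a b c"
  shows "fps_X * (1 - fps_X) * fps_deriv (fps_deriv F)
           + (fps_const c - fps_const (a + b + 1) * fps_X) * fps_deriv F - fps_const (a * b) * F = 0"
proof -
  have c1: "fps_const c = fps_const (c - 1) + 1" "fps_const (a + b + 1) = fps_const (a + b) + 1"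
    by (simp_all flip: fps_const_1_eq_1 fps_const_add)
  have "fps_X * (fps_X * (1 - fps_X) * fps_deriv (fps_deriv F)
           + (fps_const c - fps_const (a + b + 1) * fps_X) * fps_deriv F - fps_const (a * b) * F)
     = (fps_theta (fps_theta F) + fps_const (c - 1) * fps_theta F)
        - fps_X * (fps_theta (fps_theta F) + fps_const (a + b) * fps_theta F + fps_const (a * b) * F)"
    unfolding c1 by (simp add: algebra_simps)
  also have "\<dots> = 0" unfolding F_def hyp2F1_fps_ode[OF assms(1)] by simp
  finally show ?thesis by simp
qed

lemma hyp2F1_ode:
  assumes c: "c \<notin> \<int>\<^sub>\<le>\<^sub>0" and z: "norm z < 1"
  shows "z * (1 - z) * deriv (deriv (hyp2F1 a b c)) z
           + (c - (a + b + 1) * z) * deriv (hyp2F1 a b c) z - a * b * hyp2F1 a b c z = 0"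
proof (rule has_fps_expansion_0_imp_eq_0[OF _ _ z])
  note F = hyp2F1_has_fps_expansion[OF c, of a b]
  have "(\<lambda>z. z * (1 - z) * deriv (deriv (hyp2F1 a b c)) z
           + (c - (a + b + 1) * z) * deriv (hyp2F1 a b c) z - a * b * hyp2F1 a b c z)
        has_fps_expansion
        (fps_X * (1 - fps_X) * fps_deriv (fps_deriv (hyp2F1_fps a b c))
           + (fps_const c - fps_const (a + b + 1) * fps_X) * fps_deriv (hyp2F1_fps a b c)
           - fps_const (a * b) * hyp2F1_fps a b c)"
    by (intro fps_expansion_intros F)
  then show "(\<lambda>z. z * (1 - z) * deriv (deriv (hyp2F1 a b c)) z
           + (c - (a + b + 1) * z) * deriv (hyp2F1 a b c) z - a * b * hyp2F1 a b c z)
        has_fps_expansion 0"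
    by (simp only: hyp2F1_fps_ode_second_order[OF c])
  show "(\<lambda>z. z * (1 - z) * deriv (deriv (hyp2F1 a b c)) z
           + (c - (a + b + 1) * z) * deriv (hyp2F1 a b c) z - a * b * hyp2F1 a b c z)
        holomorphic_on slit_plane"
    by (intro holomorphic_intros hyp2F1_spec(1) c open_slit_plane)
qed

lemma hyp2F1_contiguous:
  assumes c: "c \<notin> \<int>\<^sub>\<le>\<^sub>0" and z: "norm z < 1"
  shows "(1 - z) * deriv (hyp2F1 a b c) z + (c - a - b) * hyp2F1 a b c z
           = (c - a) * (c - b) / c * hyp2F1 a b (c + 1) z"
proof -
  note c1 = plus_one_notin_nonpos_Ints[OF c]
  have fps: "(1 - fps_X) * fps_deriv (hyp2F1_fps a b c) + fps_const (c - a - b) * hyp2F1_fps a b c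
           - fps_const ((c - a) * (c - b) / c) * hyp2F1_fps a b (c + 1) = 0"
  proof (rule fps_ext)
    fix n
    have "(fps_X * fps_deriv (hyp2F1_fps a b c)) $ n = of_nat n * hyp2F1_coeff a b c n"
      by (simp only: fps_theta_nth hyp2F1_fps_nth)
    then have "((1 - fps_X) * fps_deriv (hyp2F1_fps a b c) + fps_const (c - a - b) * hyp2F1_fps a b c
           - fps_const ((c - a) * (c - b) / c) * hyp2F1_fps a b (c + 1)) $ n
       = of_nat (Suc n) * hyp2F1_coeff a b c (Suc n) - of_nat n * hyp2F1_coeff a b c n
           + (c - a - b) * hyp2F1_coeff a b c n - (c - a) * (c - b) / c * hyp2F1_coeff a b (c + 1) n"
      by (simp only: left_diff_distrib mult_1_left fps_sub_nth fps_add_nth fps_mult_left_const_nth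
            fps_deriv_nth hyp2F1_fps_nth Suc_eq_plus1)
    then show "((1 - fps_X) * fps_deriv (hyp2F1_fps a b c) + fps_const (c - a - b) * hyp2F1_fps a b c
           - fps_const ((c - a) * (c - b) / c) * hyp2F1_fps a b (c + 1)) $ n = 0 $ n"
      by (simp only: hyp2F1_coeff_contiguous[OF c] diff_self fps_zero_nth)
  qed
  have "(1 - z) * deriv (hyp2F1 a b c) z + (c - a - b) * hyp2F1 a b c z
           - (c - a) * (c - b) / c * hyp2F1 a b (c + 1) z = 0"
  proof (rule has_fps_expansion_0_imp_eq_0[OF _ _ z])
    show "(\<lambda>z. (1 - z) * deriv (hyp2F1 a b c) z + (c - a - b) * hyp2F1 a b c z
             - (c - a) * (c - b) / c * hyp2F1 a b (c + 1) z) has_fps_expansion 0"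
      unfolding fps[symmetric]
      by (intro fps_expansion_intros hyp2F1_has_fps_expansion c c1)
    show "(\<lambda>z. (1 - z) * deriv (hyp2F1 a b c) z + (c - a - b) * hyp2F1 a b c z
             - (c - a) * (c - b) / c * hyp2F1 a b (c + 1) z) holomorphic_on slit_plane"
      by (intro holomorphic_intros hyp2F1_spec(1) c c1 open_slit_plane)
         (use nonpos_Int_add_of_nat_neq_0[OF c, of 0] in auto)
  qed
  then show ?thesis by simp
qed

section \<open>Behaviour near 1\<close>

lemma sums_pochhammer_powr:
  fixes x \<sigma> :: real
  assumes "0 \<le> x" "x < 1"
  shows "(\<lambda>n. pochhammer \<sigma> n / fact n * x ^ n) sums (1 - x) powr (- \<sigma>)"
proof -
  have "(\<lambda>n. ((- \<sigma>) gchoose n) * (- x) ^ n) sums (1 + (- x)) powr (- \<sigma>)"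
    using assms by (intro gen_binomial_real) auto
  moreover have "((- \<sigma>) gchoose n) * (- x) ^ n = pochhammer \<sigma> n / fact n * x ^ n" for n
  proof -
    have "(- x) ^ n = (- 1) ^ n * x ^ n" by (rule power_minus)
    moreover have "(- 1) ^ n * (- 1) ^ n = (1 :: real)" by (simp flip: power_mult_distrib)
    ultimately show ?thesis by (simp add: gbinomial_pochhammer)
  qed
  ultimately show ?thesis by simp
qed

text \<open>
  The coefficients are dominated by those of (1-x)^(-\<sigma>) as soon as
  \<sigma> is positive and \<sigma> \<ge> Re(a+b-c). The condition on c-a-b leaves room for such a
  \<sigma> < 1, which makes the function integrable up to 1 and kills (1-x) F(x) there.
\<close>

lemma hyp2F1_bound_near_1:
  assumes c: "c \<notin> \<int>\<^sub>\<le>\<^sub>0" and re: "Re (c - a - b) > -1"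
  obtains C \<sigma> where "\<sigma> < 1"
    "\<And>x. 0 < x \<Longrightarrow> x < 1 \<Longrightarrow> norm (hyp2F1 a b c (of_real x)) \<le> C * (1 - x) powr (- \<sigma>)"
proof -
  \<comment> \<open>The lower bound 1/2 only keeps \<sigma> positive, so that (\<sigma>)_n is positive.\<close>
  define \<sigma> where "\<sigma> = max (Re (a + b - c)) (1 / 2)"
  have \<sigma>: "\<sigma> < 1" "\<sigma> > 0" "Re (a + b - c) \<le> \<sigma>"
    using re by (auto simp: \<sigma>_def)
  define r where "r n = norm (pochhammer a n * pochhammer b n / (pochhammer c n * pochhammer (of_real \<sigma>) n))" for n
  obtain K where K: "K > 0" "\<And>n. n > 0 \<Longrightarrow> r (Suc n) \<le> K * real n powr (Re (a + b - c - of_real \<sigma>))"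
    unfolding r_def
    by (rule pochhammer_ratio_bound[OF c, where a = a and b = b and d = "of_real \<sigma>"])
       (use \<sigma> in \<open>auto intro!: Re_pos_notin_nonpos_Ints\<close>)
  define C where "C = max K (max (r 0) (r 1))"
  have r: "r n \<le> C" for n
  proof (cases "n \<le> 1")
    case True
    then have "n = 0 \<or> n = 1" by auto
    then show ?thesis by (auto simp: C_def)
  next
    case False
    then obtain m where m: "n = Suc m" "m > 0" by (cases n) auto
    have "r n \<le> K * real m powr (Re (a + b - c - of_real \<sigma>))"
      using K(2)[OF m(2)] m(1) by simp
    also have "\<dots> \<le> K * real m powr 0"
      using K(1) m(2) \<sigma>(3) by (intro mult_left_mono powr_mono) auto
    finally show ?thesis using m(2) by (simp add: C_def)
  qed
  have coeff: "norm (hyp2F1_coeff a b c n) \<le> C * (pochhammer \<sigma> n / fact n)" for n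
  proof -
    have pos: "pochhammer \<sigma> n > 0" using \<sigma>(2) by (rule pochhammer_pos)
    have "norm (pochhammer (complex_of_real \<sigma>) n) = pochhammer \<sigma> n"
      using pos by (simp add: pochhammer_of_real)
    then have "norm (hyp2F1_coeff a b c n) = r n * (pochhammer \<sigma> n / fact n)"
      using pos by (simp add: r_def hyp2F1_coeff_def norm_mult norm_divide)
    also have "\<dots> \<le> C * (pochhammer \<sigma> n / fact n)"
      using pos by (intro mult_right_mono r) auto
    finally show ?thesis .
  qed
  show ?thesis
  proof (rule that[OF \<sigma>(1)])
    fix x :: real assume x: "0 < x" "x < 1"
    have S: "(\<lambda>n. C * (pochhammer \<sigma> n / fact n * x ^ n)) sums (C * (1 - x) powr (- \<sigma>))"
      using x by (intro sums_mult sums_pochhammer_powr) auto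
    have "hyp2F1 a b c (of_real x) = (\<Sum>n. hyp2F1_coeff a b c n * of_real x ^ n)"
      using hyp2F1_spec(2)[OF c, of "of_real x" a b] x by (simp add: sums_iff)
    also have "norm \<dots> \<le> (\<Sum>n. C * (pochhammer \<sigma> n / fact n * x ^ n))"
    proof (rule norm_suminf_le)
      show "norm (hyp2F1_coeff a b c n * of_real x ^ n) \<le> C * (pochhammer \<sigma> n / fact n * x ^ n)" for n
        using mult_right_mono[OF coeff[of n], of "x ^ n"] x
        by (simp add: norm_mult norm_power mult_ac)
    qed (use S in \<open>simp add: sums_iff\<close>)
    finally show "norm (hyp2F1 a b c (of_real x)) \<le> C * (1 - x) powr (- \<sigma>)"
      using S by (simp add: sums_iff)
  qed
qed

text \<open>
  Gauss's value is attained as a limit along the radius, because the coefficients are absolutely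
  summable.
\<close>

lemma hyp2F1_tendsto_at_1:
  assumes c: "c \<notin> \<int>\<^sub>\<le>\<^sub>0" and re: "Re (c - a - b) > 0"
  shows "((\<lambda>x. hyp2F1 a b c (of_real x)) \<longlongrightarrow>
           Gamma c * Gamma (c - a - b) * rGamma (c - a) * rGamma (c - b)) (at_left 1)"
proof -
  have I: "eventually (\<lambda>x. x \<in> {0<..<1}) (at_left (1 :: real))"
    by (rule eventually_at_left_real) simp
  have bound: "eventually (\<lambda>(n, x). norm (hyp2F1_coeff a b c n * of_real x ^ n) \<le> norm (hyp2F1_coeff a b c n))
          (sequentially \<times>\<^sub>F at_left (1 :: real))"
    unfolding eventually_prod_filter
  proof (intro exI conjI allI impI)
    show "eventually (\<lambda>_. True) sequentially" by simp
    show "eventually (\<lambda>x. x \<in> {0<..<1}) (at_left (1 :: real))" by (rule I)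
  qed (auto simp: norm_mult norm_power intro!: mult_left_le power_le_one)
  have lim: "((\<lambda>x. hyp2F1_coeff a b c n * of_real x ^ n) \<longlongrightarrow> hyp2F1_coeff a b c n * of_real 1 ^ n) (at_left (1::real))" for n
    by (intro tendsto_intros)
  have "((\<lambda>x. \<Sum>n. hyp2F1_coeff a b c n * of_real x ^ n)
          \<longlongrightarrow> (\<Sum>n. hyp2F1_coeff a b c n * of_real 1 ^ n)) (at_left (1::real))"
    using tannerys_theorem[OF lim bound summable_norm_hyp2F1_coeff[OF c re]] trivial_limit_at_left_real
    by blast
  then have "((\<lambda>x. \<Sum>n. hyp2F1_coeff a b c n * of_real x ^ n) \<longlongrightarrow>
           Gamma c * Gamma (c - a - b) * rGamma (c - a) * rGamma (c - b)) (at_left (1::real))"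
    by (simp add: gauss_summation[OF c re])
  moreover have "eventually (\<lambda>x. (\<Sum>n. hyp2F1_coeff a b c n * of_real x ^ n) = hyp2F1 a b c (of_real x)) (at_left (1::real))"
    using I
  proof eventually_elim
    case (elim x)
    then show ?case using hyp2F1_spec(2)[OF c, of "of_real x" a b] by (simp add: sums_iff)
  qed
  ultimately show ?thesis by (rule Lim_transform_eventually)
qed

section \<open>The boundary term and the recurrence\<close>

text \<open>
  The integrand is dominated by that of the Beta integral B(Re s, 1 - \<sigma>).
\<close>

lemma set_integrable_powr_mult:
  fixes \<phi> :: "real \<Rightarrow> complex"
  assumes cont: "continuous_on {0<..<1} \<phi>"
    and bound: "\<And>x. 0 < x \<Longrightarrow> x < 1 \<Longrightarrow> norm (\<phi> x) \<le> C * (1 - x) powr (- \<sigma>)"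
    and "\<sigma> < 1" "Re s > 0"
  shows "set_integrable lborel {0<..<1} (\<lambda>x. of_real x powr (s - 1) * \<phi> x)"
proof (rule set_integrable_bound)
  have "set_integrable lborel {0..1} (\<lambda>x. x powr (Re s - 1) * (1 - x) powr ((1 - \<sigma>) - 1))"
    using assms by (intro integrable_Beta) auto
  then have "set_integrable lborel {0<..<1} (\<lambda>x. x powr (Re s - 1) * (1 - x) powr ((1 - \<sigma>) - 1))"
    by (rule set_integrable_subset) auto
  then show "set_integrable lborel {0<..<1} (\<lambda>x. C * (x powr (Re s - 1) * (1 - x) powr (- \<sigma>)))"
    by (intro set_integrable_mult_right) simp
  have "continuous_on {0<..<1} (\<lambda>x. of_real x powr (s - 1) * \<phi> x)"
    by (intro continuous_intros cont) (auto simp: complex_nonpos_Reals_iff)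
  then show "set_borel_measurable lborel {0<..<1} (\<lambda>x. of_real x powr (s - 1) * \<phi> x)"
    unfolding set_borel_measurable_def
    by (simp add: borel_measurable_continuous_on_indicator)
  show "AE x in lborel. x \<in> {0<..<1} \<longrightarrow> norm (of_real x powr (s - 1) * \<phi> x)
          \<le> norm (C * (x powr (Re s - 1) * (1 - x) powr (- \<sigma>)))"
  proof (intro AE_I2 impI)
    fix x :: real assume x: "x \<in> {0<..<1}"
    have "norm (of_real x powr (s - 1) * \<phi> x) = x powr (Re s - 1) * norm (\<phi> x)"
      using x by (simp add: norm_mult norm_powr_real_powr)
    also have "\<dots> \<le> x powr (Re s - 1) * (C * (1 - x) powr (- \<sigma>))"
      using x by (intro mult_left_mono bound) auto
    also have "\<dots> \<le> norm (C * (x powr (Re s - 1) * (1 - x) powr (- \<sigma>)))"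
      by (simp add: mult_ac)
    finally show "norm (of_real x powr (s - 1) * \<phi> x)
          \<le> norm (C * (x powr (Re s - 1) * (1 - x) powr (- \<sigma>)))" .
  qed
qed

text \<open>
  The boundary term produced by integrating x^(M-1) against the differential equation, in the
  form x^M (\<theta> + c - 1 - M) f - \<epsilon> x^(M+1) (\<theta> + a + b - M - 1) f with
  f(x) = F(a,b;c;\<epsilon> x). It is taken as a function of a complex variable in order to
  use complex differentiation.
\<close>

definition mellin_boundary :: "complex \<Rightarrow> complex \<Rightarrow> complex \<Rightarrow> complex \<Rightarrow> real \<Rightarrow> complex \<Rightarrow> complex" where
  "mellin_boundary M a b c \<epsilon> w =
     w powr M * (of_real \<epsilon> * w * (1 - of_real \<epsilon> * w) * deriv (hyp2F1 a b c) (of_real \<epsilon> * w)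
       + ((c - 1 - M) - of_real \<epsilon> * w * (a + b - M - 1)) * hyp2F1 a b c (of_real \<epsilon> * w))"

text \<open>
  With F_0, F_1, F_2 the values of F, F', F'' at z, the second derivative is eliminated by the
  differential equation; the coefficients of the boundary term are exactly those for which the
  first derivative then cancels as well.
\<close>

lemma mellin_boundary_identity:
  fixes a b c M z F0 F1 F2 :: "'a :: comm_ring_1"
  assumes ode: "z * (1 - z) * F2 + (c - (a + b + 1) * z) * F1 - a * b * F0 = 0"
  shows "M * (z * (1 - z) * F1 + ((c - 1 - M) - z * (a + b - M - 1)) * F0)
           + z * ((1 - 2 * z) * F1 + z * (1 - z) * F2
                  + ((c - 1 - M) - z * (a + b - M - 1)) * F1 - (a + b - M - 1) * F0)
         = z * (M + 1 - a) * (M + 1 - b) * F0 - M * (M + 1 - c) * F0"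
proof -
  have "M * (z * (1 - z) * F1 + ((c - 1 - M) - z * (a + b - M - 1)) * F0)
           + z * ((1 - 2 * z) * F1 + z * (1 - z) * F2
                  + ((c - 1 - M) - z * (a + b - M - 1)) * F1 - (a + b - M - 1) * F0)
        = z * (M + 1 - a) * (M + 1 - b) * F0 - M * (M + 1 - c) * F0
          + z * (z * (1 - z) * F2 + (c - (a + b + 1) * z) * F1 - a * b * F0)"
    by (simp add: algebra_simps)
  then show ?thesis unfolding ode by simp
qed

lemma hyp2F1_has_derivs:
  assumes "c \<notin> \<int>\<^sub>\<le>\<^sub>0" "z \<in> slit_plane"
  shows "(hyp2F1 a b c has_field_derivative deriv (hyp2F1 a b c) z) (at z)"
    and "(deriv (hyp2F1 a b c) has_field_derivative deriv (deriv (hyp2F1 a b c)) z) (at z)"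
  using holomorphic_derivI[OF hyp2F1_spec(1)[OF assms(1)] open_slit_plane assms(2)]
    holomorphic_derivI[OF holomorphic_deriv_hyp2F1[OF assms(1)] open_slit_plane assms(2)]
  by auto

lemma hyp2F1_isCont:
  assumes "c \<notin> \<int>\<^sub>\<le>\<^sub>0" "z \<in> slit_plane"
  shows "isCont (hyp2F1 a b c) z" "isCont (deriv (hyp2F1 a b c)) z"
  using hyp2F1_has_derivs[OF assms] DERIV_isCont by blast+

lemma mellin_boundary_deriv:
  assumes c: "c \<notin> \<int>\<^sub>\<le>\<^sub>0" and w: "w \<notin> \<real>\<^sub>\<le>\<^sub>0" and z: "norm (of_real \<epsilon> * w) < 1"
  shows "(mellin_boundary M a b c \<epsilon> has_field_derivative
           of_real \<epsilon> * (M + 1 - a) * (M + 1 - b) * (w powr M * hyp2F1 a b c (of_real \<epsilon> * w))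
           - M * (M + 1 - c) * (w powr (M - 1) * hyp2F1 a b c (of_real \<epsilon> * w))) (at w)"
proof -
  let ?e = "complex_of_real \<epsilon>"
  let ?z = "?e * w"
  define F0 where "F0 = hyp2F1 a b c ?z"
  define F1 where "F1 = deriv (hyp2F1 a b c) ?z"
  define F2 where "F2 = deriv (deriv (hyp2F1 a b c)) ?z"
  have slit: "?z \<in> slit_plane" using z ball_subset_slit_plane by auto
  have w0: "w \<noteq> 0" using w by auto
  have id: "((\<lambda>w. ?e * w) has_field_derivative ?e) (at w)"
    by (auto intro!: derivative_eq_intros)
  have D0: "((\<lambda>w. hyp2F1 a b c (?e * w)) has_field_derivative F1 * ?e) (at w)"
    unfolding F1_def by (rule DERIV_chain2[OF hyp2F1_has_derivs(1)[OF c slit] id])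
  have D1: "((\<lambda>w. deriv (hyp2F1 a b c) (?e * w)) has_field_derivative F2 * ?e) (at w)"
    unfolding F2_def by (rule DERIV_chain2[OF hyp2F1_has_derivs(2)[OF c slit] id])
  have ode: "?z * (1 - ?z) * F2 + (c - (a + b + 1) * ?z) * F1 - a * b * F0 = 0"
    unfolding F0_def F1_def F2_def by (rule hyp2F1_ode[OF c z])
  have powr: "w powr M = w * w powr (M - 1)"
    using w0 by (simp add: powr_diff)
  have "(mellin_boundary M a b c \<epsilon> has_field_derivative
      M * w powr (M - 1) * (?z * (1 - ?z) * F1 + ((c - 1 - M) - ?z * (a + b - M - 1)) * F0)
      + w powr M * (?e * (1 - 2 * ?z) * F1 + ?z * (1 - ?z) * (F2 * ?e)
           + ((c - 1 - M) - ?z * (a + b - M - 1)) * (F1 * ?e) - ?e * (a + b - M - 1) * F0)) (at w)"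
    unfolding mellin_boundary_def
    by (rule derivative_eq_intros D0 D1 has_field_derivative_powr w refl)+
       (simp add: F0_def F1_def F2_def algebra_simps)
  also have "M * w powr (M - 1) * (?z * (1 - ?z) * F1 + ((c - 1 - M) - ?z * (a + b - M - 1)) * F0)
      + w powr M * (?e * (1 - 2 * ?z) * F1 + ?z * (1 - ?z) * (F2 * ?e)
           + ((c - 1 - M) - ?z * (a + b - M - 1)) * (F1 * ?e) - ?e * (a + b - M - 1) * F0)
    = w powr (M - 1) * (M * (?z * (1 - ?z) * F1 + ((c - 1 - M) - ?z * (a + b - M - 1)) * F0)
           + ?z * ((1 - 2 * ?z) * F1 + ?z * (1 - ?z) * F2
                  + ((c - 1 - M) - ?z * (a + b - M - 1)) * F1 - (a + b - M - 1) * F0))"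
    unfolding powr by (simp add: algebra_simps)
  also have "\<dots> = w powr (M - 1) * (?z * (M + 1 - a) * (M + 1 - b) * F0 - M * (M + 1 - c) * F0)"
    unfolding mellin_boundary_identity[OF ode] ..
  also have "\<dots> = ?e * (M + 1 - a) * (M + 1 - b) * (w powr M * F0) - M * (M + 1 - c) * (w powr (M - 1) * F0)"
    unfolding powr by (simp add: algebra_simps)
  finally show ?thesis unfolding F0_def .
qed

lemma mellin_boundary_tendsto_0:
  assumes c: "c \<notin> \<int>\<^sub>\<le>\<^sub>0" and M: "Re M > 0"
  shows "((\<lambda>x. mellin_boundary M a b c \<epsilon> (of_real x)) \<longlongrightarrow> 0) (at_right 0)"
proof -
  let ?e = "complex_of_real \<epsilon>"
  have slit: "?e * of_real 0 \<in> slit_plane" using ball_subset_slit_plane by auto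
  have arg: "((\<lambda>x. ?e * of_real x) \<longlongrightarrow> ?e * of_real 0) (at_right (0 :: real))"
    by (intro tendsto_intros)
  note F = isCont_tendsto_compose[OF hyp2F1_isCont(1)[OF c slit] arg]
    isCont_tendsto_compose[OF hyp2F1_isCont(2)[OF c slit] arg]
  have "((\<lambda>x. x powr Re M) \<longlongrightarrow> 0 powr Re M) (at_right (0 :: real))"
    using M by (intro tendsto_powr' tendsto_intros) (auto intro!: eventually_mono[OF eventually_at_right_less[of 0]])
  then have "((\<lambda>x. norm (of_real x powr M :: complex)) \<longlongrightarrow> 0) (at_right (0 :: real))"
    using M by (auto elim!: Lim_transform_eventually
        intro!: eventually_mono[OF eventually_at_right_less[of 0]] simp: norm_powr_real_powr)
  then have P: "((\<lambda>x. of_real x powr M :: complex) \<longlongrightarrow> 0) (at_right (0 :: real))"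
    by (rule tendsto_norm_zero_cancel)
  have "((\<lambda>x. mellin_boundary M a b c \<epsilon> (of_real x)) \<longlongrightarrow>
      0 * (?e * of_real 0 * (1 - ?e * of_real 0) * deriv (hyp2F1 a b c) (?e * of_real 0)
       + ((c - 1 - M) - ?e * of_real 0 * (a + b - M - 1)) * hyp2F1 a b c (?e * of_real 0))) (at_right 0)"
    unfolding mellin_boundary_def by (intro tendsto_intros F P)
  then show ?thesis by simp
qed

lemma mellin_boundary_tendsto_minus_1:
  assumes c: "c \<notin> \<int>\<^sub>\<le>\<^sub>0"
  shows "((\<lambda>x. mellin_boundary M a b c (-1) (of_real x)) \<longlongrightarrow> E_minus M a b c) (at_left 1)"
proof -
  have slit: "complex_of_real (-1) * of_real 1 \<in> slit_plane"
    by (auto simp: slit_plane_def complex_eq_iff)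
  have arg: "((\<lambda>x. complex_of_real (-1) * of_real x) \<longlongrightarrow> complex_of_real (-1) * of_real 1) (at_left (1 :: real))"
    by (intro tendsto_intros)
  note F = isCont_tendsto_compose[OF hyp2F1_isCont(1)[OF c slit] arg]
    isCont_tendsto_compose[OF hyp2F1_isCont(2)[OF c slit] arg]
  have "isCont (\<lambda>x. complex_of_real x powr M) (1 :: real)"
    by (intro continuous_intros) (auto simp: complex_nonpos_Reals_iff)
  then have P: "((\<lambda>x. complex_of_real x powr M) \<longlongrightarrow> of_real 1 powr M) (at_left 1)"
    unfolding isCont_def by (rule filterlim_mono) (auto simp: at_le)
  have "((\<lambda>x. mellin_boundary M a b c (-1) (of_real x)) \<longlongrightarrow>
      of_real 1 powr M * (of_real (-1) * of_real 1 * (1 - of_real (-1) * of_real 1) * deriv (hyp2F1 a b c) (of_real (-1) * of_real 1)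
       + ((c - 1 - M) - of_real (-1) * of_real 1 * (a + b - M - 1)) * hyp2F1 a b c (of_real (-1) * of_real 1))) (at_left 1)"
    unfolding mellin_boundary_def by (intro tendsto_intros F P)
  then show ?thesis by (simp add: E_minus_def algebra_simps)
qed

text \<open>
  For \<epsilon> = 1 the boundary term equals
  x^M ( x [(1-x)F' + (c-a-b)F] + (c-1-M)(1-x)F ). The bracket is a multiple of
  F(a,b;c+1;x), whose limit is given by Gauss's theorem; the last summand tends to 0. Neither
  F nor (1-x)F' need have a limit of its own.
\<close>

lemma mellin_boundary_tendsto_plus_1:
  assumes c: "c \<notin> \<int>\<^sub>\<le>\<^sub>0" and re: "Re (c - a - b) > -1"
  shows "((\<lambda>x. mellin_boundary M a b c 1 (of_real x)) \<longlongrightarrow> E_plus a b c) (at_left 1)"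
proof -
  have I: "eventually (\<lambda>x. x \<in> {0<..<1}) (at_left (1 :: real))"
    by (rule eventually_at_left_real) simp
  have c0: "c \<noteq> 0" using c by auto
  define G where "G = Gamma (c + 1) * Gamma (c + 1 - a - b) * rGamma (c + 1 - a) * rGamma (c + 1 - b)"
  have G: "((\<lambda>x. hyp2F1 a b (c + 1) (of_real x)) \<longlongrightarrow> G) (at_left 1)"
    unfolding G_def using re
    by (intro hyp2F1_tendsto_at_1 plus_one_notin_nonpos_Ints c) auto
  have "isCont (\<lambda>x. complex_of_real x powr M) (1 :: real)"
    by (intro continuous_intros) (auto simp: complex_nonpos_Reals_iff)
  then have P: "((\<lambda>x. complex_of_real x powr M) \<longlongrightarrow> of_real 1 powr M) (at_left 1)"
    unfolding isCont_def by (rule filterlim_mono) (auto simp: at_le)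
  obtain C \<sigma> where \<sigma>: "\<sigma> < 1" and
    bound: "\<And>x. 0 < x \<Longrightarrow> x < 1 \<Longrightarrow> norm (hyp2F1 a b c (of_real x)) \<le> C * (1 - x) powr (- \<sigma>)"
    using hyp2F1_bound_near_1[OF c re] by blast
  have van: "((\<lambda>x. (1 - of_real x) * hyp2F1 a b c (of_real x)) \<longlongrightarrow> 0) (at_left (1 :: real))"
  proof (rule Lim_null_comparison)
    show "eventually (\<lambda>x. norm ((1 - of_real x) * hyp2F1 a b c (of_real x)) \<le> C * (1 - x) powr (1 - \<sigma>)) (at_left (1::real))"
      using I
    proof eventually_elim
      case (elim x)
      have "norm (1 - complex_of_real x) = 1 - x"
        using elim by (metis abs_of_pos diff_gt_0_iff_gt greaterThanLessThan_iff norm_of_real of_real_1 of_real_diff)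
      then have "norm ((1 - of_real x) * hyp2F1 a b c (of_real x)) \<le> (1 - x) * (C * (1 - x) powr (- \<sigma>))"
        using bound[of x] elim by (simp add: norm_mult mult_left_mono)
      also have "\<dots> = C * (1 - x) powr (1 - \<sigma>)"
        using elim by (simp add: powr_diff powr_minus divide_inverse)
      finally show ?case .
    qed
    have "((\<lambda>x. (1 - x) powr (1 - \<sigma>)) \<longlongrightarrow> (1 - 1) powr (1 - \<sigma>)) (at_left (1 :: real))"
      using \<sigma> by (intro tendsto_powr' tendsto_intros)
        (auto intro!: eventually_mono[OF I])
    then show "((\<lambda>x. C * (1 - x) powr (1 - \<sigma>)) \<longlongrightarrow> 0) (at_left (1 :: real))"
      using \<sigma> by (intro tendsto_mult_right_zero) simp
  qed
  have lim: "((\<lambda>x. of_real x powr M * (of_real x * ((c - a) * (c - b) / c * hyp2F1 a b (c + 1) (of_real x))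
           + (c - 1 - M) * ((1 - of_real x) * hyp2F1 a b c (of_real x))))
        \<longlongrightarrow> of_real 1 powr M * (of_real 1 * ((c - a) * (c - b) / c * G) + (c - 1 - M) * 0)) (at_left (1::real))"
    by (intro tendsto_intros P G van)
  have "eventually (\<lambda>x. of_real x powr M * (of_real x * ((c - a) * (c - b) / c * hyp2F1 a b (c + 1) (of_real x))
           + (c - 1 - M) * ((1 - of_real x) * hyp2F1 a b c (of_real x)))
          = mellin_boundary M a b c 1 (of_real x)) (at_left (1 :: real))"
    using I
  proof eventually_elim
    case (elim x)
    have "norm (complex_of_real x) < 1" using elim by simp
    show ?case
      unfolding mellin_boundary_def hyp2F1_contiguous[OF c \<open>norm (complex_of_real x) < 1\<close>, symmetric]
      by (simp add: algebra_simps)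
  qed
  from Lim_transform_eventually[OF lim this]
  have "((\<lambda>x. mellin_boundary M a b c 1 (of_real x)) \<longlongrightarrow> (c - a) * (c - b) / c * G) (at_left 1)"
    by simp
  also have "(c - a) * (c - b) / c * G = E_plus a b c"
  proof -
    have shift: "c + 1 - a = (c - a) + 1" "c + 1 - b = (c - b) + 1" "c - a + 1 - b = c - a - b + 1"
      by simp_all
    have "(c - a) * (c - b) / c * G
        = Gamma (c + 1) / c * Gamma (c - a - b + 1)
          * ((c - a) * rGamma (c - a + 1)) * ((c - b) * rGamma (c - b + 1))"
      unfolding G_def shift by (simp add: mult_ac)
    also have "\<dots> = E_plus a b c"
      unfolding rGamma_plus1 Gamma_plus1[OF c] E_plus_def using c0 by simp
    finally show ?thesis .
  qed
  finally show ?thesis .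
qed

lemma mellin_boundary_tendsto_1:
  assumes "c \<notin> \<int>\<^sub>\<le>\<^sub>0" "\<epsilon> \<in> {1, -1}" "\<epsilon> = 1 \<Longrightarrow> Re (c - a - b) > -1"
  shows "((\<lambda>x. mellin_boundary M a b c \<epsilon> (of_real x)) \<longlongrightarrow> E_term \<epsilon> M a b c) (at_left 1)"
  using assms mellin_boundary_tendsto_minus_1 mellin_boundary_tendsto_plus_1
  by (auto simp: E_term_def)

text \<open>
  For \<epsilon> = -1 the points \<epsilon> x run through a compact subset of the cut
  plane, so \<sigma> = 0 will do.
\<close>

lemma hyp2F1_bound_on_unit_interval:
  assumes c: "c \<notin> \<int>\<^sub>\<le>\<^sub>0" and \<epsilon>: "\<epsilon> \<in> {1, -1}" and re: "\<epsilon> = 1 \<Longrightarrow> Re (c - a - b) > -1"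
  obtains C \<sigma> where "\<sigma> < 1"
    "\<And>x. 0 < x \<Longrightarrow> x < 1 \<Longrightarrow> norm (hyp2F1 a b c (of_real (\<epsilon> * x))) \<le> C * (1 - x) powr (- \<sigma>)"
proof (cases "\<epsilon> = 1")
  case True
  then show ?thesis using hyp2F1_bound_near_1[OF c re[OF True]] that by auto
next
  case False
  with \<epsilon> have \<epsilon>': "\<epsilon> = -1" by simp
  have "continuous_on {0..1} (\<lambda>x. hyp2F1 a b c (of_real (- x)))"
  proof (rule continuous_on_compose2[OF holomorphic_on_imp_continuous_on[OF hyp2F1_spec(1)[OF c]]])
    show "(\<lambda>x. complex_of_real (- x)) ` {0..1} \<subseteq> slit_plane"
      by (auto simp: slit_plane_def complex_eq_iff)
  qed (intro continuous_intros)
  then have "bounded ((\<lambda>x. hyp2F1 a b c (of_real (- x))) ` {0..1})"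
    by (intro compact_imp_bounded compact_continuous_image) auto
  then obtain C where C: "\<And>x. x \<in> {0..1} \<Longrightarrow> norm (hyp2F1 a b c (of_real (- x))) \<le> C"
    unfolding bounded_iff by blast
  show ?thesis
  proof (rule that[of 0 C])
    fix x :: real assume "0 < x" "x < 1"
    then show "norm (hyp2F1 a b c (of_real (\<epsilon> * x))) \<le> C * (1 - x) powr (- 0)"
      using C[of x] \<epsilon>' by simp
  qed simp
qed

lemma set_integrable_powr_hyp2F1:
  assumes c: "c \<notin> \<int>\<^sub>\<le>\<^sub>0" and \<epsilon>: "\<epsilon> \<in> {1, -1}" and re: "\<epsilon> = 1 \<Longrightarrow> Re (c - a - b) > -1"
    and s: "Re s > 0"
  shows "set_integrable lborel {0<..<1} (\<lambda>x. of_real x powr (s - 1) * hyp2F1 a b c (of_real (\<epsilon> * x)))"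
proof -
  obtain C \<sigma> where \<sigma>: "\<sigma> < 1"
    "\<And>x. 0 < x \<Longrightarrow> x < 1 \<Longrightarrow> norm (hyp2F1 a b c (of_real (\<epsilon> * x))) \<le> C * (1 - x) powr (- \<sigma>)"
    using hyp2F1_bound_on_unit_interval[OF c \<epsilon> re] by blast
  have "continuous_on {0<..<1} (\<lambda>x. hyp2F1 a b c (of_real (\<epsilon> * x)))"
  proof (rule continuous_on_compose2[OF holomorphic_on_imp_continuous_on[OF hyp2F1_spec(1)[OF c]]])
    show "(\<lambda>x. complex_of_real (\<epsilon> * x)) ` {0<..<1} \<subseteq> slit_plane"
      using \<epsilon> by (auto simp: slit_plane_def complex_eq_iff)
  qed (intro continuous_intros)
  from set_integrable_powr_mult[OF this \<sigma>(2,1) s] show ?thesis .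
qed

theorem theorem2p2:
  fixes a b c \<mu> M :: complex and \<epsilon> :: real and m :: nat
  assumes "c \<notin> \<int>\<^sub>\<le>\<^sub>0"
    and "\<epsilon> \<in> {1, -1}"
    and "m \<ge> 1"
    and "M = of_nat m + \<mu>"
    and "Re M > 0"
    and "\<epsilon> = 1 \<Longrightarrow> Re (c - a - b) > -1"
  shows "set_integrable lborel {0<..<1} (Phi_integrand a b c \<mu> m \<epsilon>) \<and>
         set_integrable lborel {0<..<1} (Phi_integrand a b c \<mu> (m - 1) \<epsilon>) \<and>
         of_real \<epsilon> * (M + 1 - a) * (M + 1 - b) * Phi a b c \<mu> m \<epsilon> =
           M * (M + 1 - c) * Phi a b c \<mu> (m - 1) \<epsilon> + E_term \<epsilon> M a b c"
proof -
  note c = assms(1) and \<epsilon> = assms(2) and re = assms(6)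
  define \<phi> where "\<phi> s x = complex_of_real x powr s * hyp2F1 a b c (of_real (\<epsilon> * x))" for s x
  have Phi_m: "Phi_integrand a b c \<mu> m \<epsilon> = \<phi> M"
    unfolding Phi_integrand_def \<phi>_def assms(4) ..
  have Phi_m1: "Phi_integrand a b c \<mu> (m - 1) \<epsilon> = \<phi> (M - 1)"
    unfolding Phi_integrand_def \<phi>_def assms(4) using assms(3) by (simp add: of_nat_diff algebra_simps)
  have int: "set_integrable lborel {0<..<1} (\<phi> M)" "set_integrable lborel {0<..<1} (\<phi> (M - 1))"
    using set_integrable_powr_hyp2F1[OF c \<epsilon> re, of "M + 1"]
      set_integrable_powr_hyp2F1[OF c \<epsilon> re assms(5)] assms(5)
    unfolding \<phi>_def by simp_all
  define k1 where "k1 = of_real \<epsilon> * (M + 1 - a) * (M + 1 - b)"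
  define k2 where "k2 = M * (M + 1 - c)"
  define f where "f x = k1 * \<phi> M x - k2 * \<phi> (M - 1) x" for x
  define W where "W x = mellin_boundary M a b c \<epsilon> (of_real x)" for x
  have f_int: "set_integrable lborel {0<..<1} f"
    unfolding f_def by (intro set_integral_diff(1) set_integrable_mult_right int)
  have f_cont: "isCont f x" if "0 < x" "x < 1" for x
  proof -
    have "complex_of_real (\<epsilon> * x) \<in> slit_plane"
      using that \<epsilon> by (auto simp: slit_plane_def complex_eq_iff)
    then have "isCont (\<lambda>x. hyp2F1 a b c (complex_of_real (\<epsilon> * x))) x"
      by (intro isCont_o2[OF _ hyp2F1_isCont(1)[OF c]] continuous_intros)
    then show ?thesis
      unfolding f_def \<phi>_def using that
      by (intro continuous_intros) (auto simp: complex_nonpos_Reals_iff)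
  qed
  have deriv: "(W has_vector_derivative f x) (at x)" if "0 < x" "x < 1" for x
  proof -
    have "norm (of_real \<epsilon> * complex_of_real x) < 1" "complex_of_real x \<notin> \<real>\<^sub>\<le>\<^sub>0"
      using that \<epsilon> by (auto simp: norm_mult)
    from has_vector_derivative_real_field[OF mellin_boundary_deriv[OF c this(2,1), of M a b]]
    show ?thesis unfolding W_def f_def \<phi>_def k1_def k2_def by simp
  qed
  \<comment> \<open>The derivative of the boundary term is integrable, so the fundamental theorem applies on the
    open interval with the one-sided limits as end values.\<close>
  have "(LBINT x=ereal 0..ereal 1. f x) = E_term \<epsilon> M a b c - 0"
  proof (rule interval_integral_FTC_integrable)
    show "((W \<circ> real_of_ereal) \<longlongrightarrow> 0) (at_right (ereal 0))"
      unfolding ereal_tendsto_simps W_def by (rule mellin_boundary_tendsto_0[OF c assms(5)])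
    show "((W \<circ> real_of_ereal) \<longlongrightarrow> E_term \<epsilon> M a b c) (at_left (ereal 1))"
      unfolding ereal_tendsto_simps W_def by (rule mellin_boundary_tendsto_1[OF c \<epsilon> re])
  qed (use deriv f_cont f_int in auto)
  also have "(LBINT x=ereal 0..ereal 1. f x) = (LINT x:{0<..<1}|lborel. f x)"
    by (subst interval_integral_Ioo) auto
  also have "\<dots> = k1 * (LINT x:{0<..<1}|lborel. \<phi> M x) - k2 * (LINT x:{0<..<1}|lborel. \<phi> (M - 1) x)"
    unfolding f_def using int by (subst set_integral_diff(2)) auto
  finally have "k1 * Phi a b c \<mu> m \<epsilon> = k2 * Phi a b c \<mu> (m - 1) \<epsilon> + E_term \<epsilon> M a b c"
    unfolding Phi_def Phi_m Phi_m1 by (simp add: algebra_simps)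
  with int show ?thesis unfolding Phi_m Phi_m1 k1_def k2_def by blast
qed

end
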